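(* Let $\mathcal{A}$ be a Banach algebra and let $E$ be a Banach left $\mathcal{A}$-module. Then there exist an ultrafilter $\mathcal{U}$ (on some index set) and a map $K:E''\rightarrow(E)_{\mathcal{U}}$ such that: (1) $K$ is a linear isometry and a left $\mathcal{A}$-module homomorphism; (2) $\sigma_{\mathcal{U}}\circ K$ is the identity on $E''$; (3) $K\circ\kappa_E:E\rightarrow(E)_{\mathcal{U}}$ is the canonical map. The analogous results hold for Banach right $\mathcal{A}$-modules (with $K$ a right $\mathcal{A}$-module homomorphism) and for Banach $\mathcal{A}$-bimodules (with $K$ an $\mathcal{A}$-bimodule homomorphism).
   Context: $E'$ denotes the dual of a Banach space $E$, $\langle\mu,x\rangle=\mu(x)$, and $\kappa_E:E\rightarrow E''$ is the canonical embedding. Ultrapowers: for a non-principal ultrafilter $\mathcal{U}$ on a set $I$, $(E)_{\mathcal{U}}=\ell^\infty(E,I)/\mathcal{N}_{\mathcal{U}}$, where $\ell^\infty(E,I)$ is the space of bounded families $(x_i)_{i\in I}$ in $E$ with the supremum norm and $\mathcal{N}_{\mathcal{U}}=\{(x_i):\lim_{i\rightarrow\mathcal{U}}\|x_i\|=0\}$; the quotient norm is $\lim_{i\rightarrow\mathcal{U}}\|x_i\|$. The class of $(x_i)$ is again written $(x_i)$. The canonical map $E\rightarrow(E)_{\mathcal{U}}$ sends $x$ to the constant family $(x)$. All ultrafilters are assumed countably incomplete (some countable subfamily of $\mathcal{U}$ has intersection not in $\mathcal{U}$). The map $\sigma_{\mathcal{U}}:(E)_{\mathcal{U}}\rightarrow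 E''$ is given by $\langle\sigma_{\mathcal{U}}((x_i)),\mu\rangle=\lim_{i\rightarrow\mathcal{U}}\langle\mu,x_i\rangle$ for $\mu\in E'$. Module structures: $(E)_{\mathcal{U}}$ is an $\mathcal{A}$-module with the pointwise action, $a\cdot(x_i)=(a\cdot x_i)$. For a left module $E$, $E'$ is a right $\mathcal{A}$-module via $\langle\mu\cdot a,x\rangle=\langle\mu,a\cdot x\rangle$, and $E''$ is a left $\mathcal{A}$-module via $\langle a\cdot\Phi,\mu\rangle=\langle\Phi,\mu\cdot a\rangle$; similarly for right modules and bimodules. *)

theory Defs
  imports "HOL-Analysis.Analysis"
begin

section \<open>Scalars, Banach spaces, Banach algebras and modules\<close>

text \<open>The only scalar fields are (up to isometric isomorphism) the reals and the complex numbers;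
  working over this class treats both cases at once.\<close>

class real_or_complex = real_normed_field +
  assumes real_or_complex_embedding:
    "\<exists>h :: 'a \<Rightarrow> complex. (\<forall>x y. h (x + y) = h x + h y) \<and> (\<forall>x y. h (x * y) = h x * h y) \<and>
       (\<forall>r x. h (r *\<^sub>R x) = r *\<^sub>R h x) \<and> (\<forall>x. norm (h x) = norm x) \<and>
       (range h = \<real> \<or> range h = UNIV)"

instance real :: real_or_complex
proof
  have "range complex_of_real = \<real>"
    by (simp only: Reals_def)
  then show "\<exists>h :: real \<Rightarrow> complex. (\<forall>x y. h (x + y) = h x + h y) \<and> (\<forall>x y. h (x * y) = h x * h y) \<and>
      (\<forall>r x. h (r *\<^sub>R x) = r *\<^sub>R h x) \<and> (\<forall>x. norm (h x) = norm x) \<and>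
      (range h = \<real> \<or> range h = UNIV)"
    by (intro exI[of _ complex_of_real] conjI allI disjI1) (simp_all add: scaleR_conv_of_real)
qed

instance complex :: real_or_complex
proof
  show "\<exists>h :: complex \<Rightarrow> complex. (\<forall>x y. h (x + y) = h x + h y) \<and> (\<forall>x y. h (x * y) = h x * h y) \<and>
      (\<forall>r x. h (r *\<^sub>R x) = r *\<^sub>R h x) \<and> (\<forall>x. norm (h x) = norm x) \<and>
      (range h = \<real> \<or> range h = UNIV)"
    by (intro exI[of _ "\<lambda>z. z"] conjI allI disjI2) simp_all
qed

text \<open>The type class \<^class>\<open>banach\<close> only provides the underlying real Banach space;
  \<open>s\<close> is the scalar multiplication by the field \<open>'k\<close>, extending the real one.\<close>

locale banach_space_over = vector_space s
  for s :: "'k::real_or_complex \<Rightarrow> 'e::banach \<Rightarrow> 'e" +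
  assumes scale_of_real: "s (of_real r) x = r *\<^sub>R x"
    and norm_scale: "norm (s c x) = norm c * norm x"

text \<open>Banach algebras need not be unital. The multiplication is that of the type,
  submultiplicativity of the norm is part of \<^class>\<open>real_normed_algebra\<close>.\<close>

locale banach_algebra_over = banach_space_over s
  for s :: "'k::real_or_complex \<Rightarrow> 'a::{real_normed_algebra,banach} \<Rightarrow> 'a" +
  assumes scale_mult_left: "s c a * b = s c (a * b)"
    and scale_mult_right: "a * s c b = s c (a * b)"

text \<open>The module actions are only required to be bounded, not contractive.\<close>

locale banach_left_module = A: banach_algebra_over sA + E: banach_space_over sE
  for sA :: "'k::real_or_complex \<Rightarrow> 'a::{real_normed_algebra,banach} \<Rightarrow> 'a"
    and sE :: "'k \<Rightarrow> 'e::banach \<Rightarrow> 'e" +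
  fixes l :: "'a \<Rightarrow> 'e \<Rightarrow> 'e"
  assumes lact_bounded_bilinear: "bounded_bilinear l"
    and lact_scale_left: "l (sA c a) x = sE c (l a x)"
    and lact_scale_right: "l a (sE c x) = sE c (l a x)"
    and lact_mult: "l (a * b) x = l a (l b x)"

locale banach_right_module = A: banach_algebra_over sA + E: banach_space_over sE
  for sA :: "'k::real_or_complex \<Rightarrow> 'a::{real_normed_algebra,banach} \<Rightarrow> 'a"
    and sE :: "'k \<Rightarrow> 'e::banach \<Rightarrow> 'e" +
  fixes r :: "'e \<Rightarrow> 'a \<Rightarrow> 'e"
  assumes ract_bounded_bilinear: "bounded_bilinear r"
    and ract_scale_right: "r x (sA c a) = sE c (r x a)"
    and ract_scale_left: "r (sE c x) a = sE c (r x a)"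
    and ract_mult: "r x (a * b) = r (r x a) b"

locale banach_bimodule = banach_left_module sA sE l + banach_right_module sA sE r
  for sA :: "'k::real_or_complex \<Rightarrow> 'a::{real_normed_algebra,banach} \<Rightarrow> 'a"
    and sE :: "'k \<Rightarrow> 'e::banach \<Rightarrow> 'e"
    and l :: "'a \<Rightarrow> 'e \<Rightarrow> 'e"
    and r :: "'e \<Rightarrow> 'a \<Rightarrow> 'e" +
  assumes lact_ract: "r (l a x) b = l a (r x b)"


section \<open>Dual and bidual\<close>

text \<open>The dual consists of the \<open>'k\<close>-linear elements of the type of bounded real-linear maps,
  and carries the operator norm of that type.\<close>

definition dual :: "('k::real_or_complex \<Rightarrow> 'e::banach \<Rightarrow> 'e) \<Rightarrow> ('e \<Rightarrow>\<^sub>L 'k) set" where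
  "dual s = {\<mu>. \<forall>c x. blinfun_apply \<mu> (s c x) = c * blinfun_apply \<mu> x}"

definition dual_scale :: "'k::real_or_complex \<Rightarrow> ('e::banach \<Rightarrow>\<^sub>L 'k) \<Rightarrow> ('e \<Rightarrow>\<^sub>L 'k)" where
  "dual_scale c \<mu> = blinfun_mult_right c o\<^sub>L \<mu>"

text \<open>Bounded \<open>'k\<close>-linear functionals on the dual. As the dual is a proper subset of its type in
  general, functionals are normalised to be \<open>0\<close> off the dual; thus equality of functions is
  equality of functionals, and the vector space operations are pointwise.\<close>

type_synonym ('k, 'e) functional2 = "('e \<Rightarrow>\<^sub>L 'k) \<Rightarrow> 'k"

definition bidual :: "('k::real_or_complex \<Rightarrow> 'e::banach \<Rightarrow> 'e) \<Rightarrow> ('k, 'e) functional2 set" where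
  "bidual s = {\<Phi>. (\<forall>\<mu>. \<mu> \<notin> dual s \<longrightarrow> \<Phi> \<mu> = 0) \<and>
     (\<forall>\<mu>\<in>dual s. \<forall>\<nu>\<in>dual s. \<Phi> (\<mu> + \<nu>) = \<Phi> \<mu> + \<Phi> \<nu>) \<and>
     (\<forall>c. \<forall>\<mu>\<in>dual s. \<Phi> (dual_scale c \<mu>) = c * \<Phi> \<mu>) \<and>
     (\<exists>C. \<forall>\<mu>\<in>dual s. norm (\<Phi> \<mu>) \<le> C * norm \<mu>)}"

definition bidual_norm ::
    "('k::real_or_complex \<Rightarrow> 'e::banach \<Rightarrow> 'e) \<Rightarrow> ('k, 'e) functional2 \<Rightarrow> real" where
  "bidual_norm s \<Phi> = (SUP \<mu>\<in>{\<mu>\<in>dual s. norm \<mu> \<le> 1}. norm (\<Phi> \<mu>))"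

definition bidual_add ::
    "('k::real_or_complex, 'e::banach) functional2 \<Rightarrow> ('k, 'e) functional2 \<Rightarrow> ('k, 'e) functional2"
  where "bidual_add \<Phi> \<Psi> = (\<lambda>\<mu>. \<Phi> \<mu> + \<Psi> \<mu>)"

definition bidual_scale ::
    "'k::real_or_complex \<Rightarrow> ('k, 'e::banach) functional2 \<Rightarrow> ('k, 'e) functional2" where
  "bidual_scale c \<Phi> = (\<lambda>\<mu>. c * \<Phi> \<mu>)"

definition canonical_embedding ::
    "('k::real_or_complex \<Rightarrow> 'e::banach \<Rightarrow> 'e) \<Rightarrow> 'e \<Rightarrow> ('k, 'e) functional2" where
  "canonical_embedding s x = (\<lambda>\<mu>. if \<mu> \<in> dual s then blinfun_apply \<mu> x else 0)"

definition dual_ract ::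
    "('a \<Rightarrow> 'e \<Rightarrow> 'e) \<Rightarrow> ('e::banach \<Rightarrow>\<^sub>L 'k::real_or_complex) \<Rightarrow> 'a \<Rightarrow> ('e \<Rightarrow>\<^sub>L 'k)" where
  "dual_ract l \<mu> a = Blinfun (\<lambda>x. blinfun_apply \<mu> (l a x))"

definition dual_lact ::
    "('e \<Rightarrow> 'a \<Rightarrow> 'e) \<Rightarrow> 'a \<Rightarrow> ('e::banach \<Rightarrow>\<^sub>L 'k::real_or_complex) \<Rightarrow> ('e \<Rightarrow>\<^sub>L 'k)" where
  "dual_lact r a \<mu> = Blinfun (\<lambda>x. blinfun_apply \<mu> (r x a))"

definition bidual_lact ::
    "('k::real_or_complex \<Rightarrow> 'e::banach \<Rightarrow> 'e) \<Rightarrow> ('a \<Rightarrow> 'e \<Rightarrow> 'e) \<Rightarrow>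
      'a \<Rightarrow> ('k, 'e) functional2 \<Rightarrow> ('k, 'e) functional2" where
  "bidual_lact s l a \<Phi> = (\<lambda>\<mu>. if \<mu> \<in> dual s then \<Phi> (dual_ract l \<mu> a) else 0)"

definition bidual_ract ::
    "('k::real_or_complex \<Rightarrow> 'e::banach \<Rightarrow> 'e) \<Rightarrow> ('e \<Rightarrow> 'a \<Rightarrow> 'e) \<Rightarrow>
      ('k, 'e) functional2 \<Rightarrow> 'a \<Rightarrow> ('k, 'e) functional2" where
  "bidual_ract s r \<Phi> a = (\<lambda>\<mu>. if \<mu> \<in> dual s then \<Phi> (dual_lact r a \<mu>) else 0)"

lemma (in banach_left_module) dual_ract_apply:
  "blinfun_apply (dual_ract l \<mu> a) x = blinfun_apply \<mu> (l a x)"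
  unfolding dual_ract_def
  by (subst bounded_linear_Blinfun_apply,
      rule bounded_linear_compose[OF blinfun.bounded_linear_right
        bounded_bilinear.bounded_linear_right[OF lact_bounded_bilinear]]) (rule refl)

lemma (in banach_right_module) dual_lact_apply:
  "blinfun_apply (dual_lact r a \<mu>) x = blinfun_apply \<mu> (r x a)"
  unfolding dual_lact_def
  by (subst bounded_linear_Blinfun_apply,
      rule bounded_linear_compose[OF blinfun.bounded_linear_right
        bounded_bilinear.bounded_linear_left[OF ract_bounded_bilinear]]) (rule refl)


section \<open>Ultrapowers\<close>

text \<open>A filter on the type \<open>'i\<close> is a family of subsets of the index set \<open>UNIV :: 'i set\<close>;
  \<open>A\<close> belongs to it iff \<open>eventually (\<lambda>i. i \<in> A) U\<close>.\<close>

definition ultrafilter :: "'i filter \<Rightarrow> bool" where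
  "ultrafilter U \<longleftrightarrow> U \<noteq> bot \<and> (\<forall>P. eventually P U \<or> eventually (\<lambda>i. \<not> P i) U)"

definition nonprincipal :: "'i filter \<Rightarrow> bool" where
  "nonprincipal U \<longleftrightarrow> (\<forall>j. \<not> eventually (\<lambda>i. i = j) U)"

definition countably_incomplete :: "'i filter \<Rightarrow> bool" where
  "countably_incomplete U \<longleftrightarrow>
     (\<exists>S. countable S \<and> (\<forall>A\<in>S. eventually (\<lambda>i. i \<in> A) U) \<and> \<not> eventually (\<lambda>i. i \<in> \<Inter>S) U)"

definition bounded_families :: "('i \<Rightarrow> 'e::banach) set" where
  "bounded_families = {x. bounded (range x)}"

definition null_families :: "'i filter \<Rightarrow> ('i \<Rightarrow> 'e::banach) set" where
  "null_families U = {x \<in> bounded_families. ((\<lambda>i. norm (x i)) \<longlongrightarrow> 0) U}"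

definition ultrapower_rel :: "'i filter \<Rightarrow> (('i \<Rightarrow> 'e::banach) \<times> ('i \<Rightarrow> 'e)) set" where
  "ultrapower_rel U =
     {(x, y). x \<in> bounded_families \<and> y \<in> bounded_families \<and> (\<lambda>i. x i - y i) \<in> null_families U}"

definition ultrapower :: "'i filter \<Rightarrow> ('i \<Rightarrow> 'e::banach) set set" where
  "ultrapower U = bounded_families // ultrapower_rel U"

definition ultrapower_class :: "'i filter \<Rightarrow> ('i \<Rightarrow> 'e::banach) \<Rightarrow> ('i \<Rightarrow> 'e) set" where
  "ultrapower_class U x = ultrapower_rel U `` {x}"

text \<open>Operations on classes are given by arbitrary representatives. The union of the classes, and
  \<^const>\<open>the_elem\<close> of the set of values, express that the result does not depend on the choice.\<close>

definition ultrapower_norm :: "'i filter \<Rightarrow> ('i \<Rightarrow> 'e::banach) set \<Rightarrow> real" where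
  "ultrapower_norm U X = the_elem ((\<lambda>x. Lim U (\<lambda>i. norm (x i))) ` X)"

definition ultrapower_add ::
    "'i filter \<Rightarrow> ('i \<Rightarrow> 'e::banach) set \<Rightarrow> ('i \<Rightarrow> 'e) set \<Rightarrow> ('i \<Rightarrow> 'e) set" where
  "ultrapower_add U X Y = (\<Union>x\<in>X. \<Union>y\<in>Y. ultrapower_class U (\<lambda>i. x i + y i))"

definition ultrapower_scale ::
    "('k::real_or_complex \<Rightarrow> 'e::banach \<Rightarrow> 'e) \<Rightarrow> 'i filter \<Rightarrow>
      'k \<Rightarrow> ('i \<Rightarrow> 'e) set \<Rightarrow> ('i \<Rightarrow> 'e) set" where
  "ultrapower_scale s U c X = (\<Union>x\<in>X. ultrapower_class U (\<lambda>i. s c (x i)))"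

definition ultrapower_lact ::
    "('a \<Rightarrow> 'e \<Rightarrow> 'e) \<Rightarrow> 'i filter \<Rightarrow> 'a \<Rightarrow> ('i \<Rightarrow> 'e::banach) set \<Rightarrow> ('i \<Rightarrow> 'e) set" where
  "ultrapower_lact l U a X = (\<Union>x\<in>X. ultrapower_class U (\<lambda>i. l a (x i)))"

definition ultrapower_ract ::
    "('e \<Rightarrow> 'a \<Rightarrow> 'e) \<Rightarrow> 'i filter \<Rightarrow> ('i \<Rightarrow> 'e::banach) set \<Rightarrow> 'a \<Rightarrow> ('i \<Rightarrow> 'e) set" where
  "ultrapower_ract r U X a = (\<Union>x\<in>X. ultrapower_class U (\<lambda>i. r (x i) a))"

definition ultrapower_canonical :: "'i filter \<Rightarrow> 'e::banach \<Rightarrow> ('i \<Rightarrow> 'e) set" where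
  "ultrapower_canonical U x = ultrapower_class U (\<lambda>i. x)"

definition ultrapower_sigma ::
    "('k::real_or_complex \<Rightarrow> 'e::banach \<Rightarrow> 'e) \<Rightarrow> 'i filter \<Rightarrow>
      ('i \<Rightarrow> 'e) set \<Rightarrow> ('k, 'e) functional2" where
  "ultrapower_sigma s U X =
     (\<lambda>\<mu>. if \<mu> \<in> dual s then the_elem ((\<lambda>x. Lim U (\<lambda>i. blinfun_apply \<mu> (x i))) ` X) else 0)"

lemma equiv_ultrapower_rel:
  fixes U :: "'i filter"
  shows "equiv (bounded_families :: ('i \<Rightarrow> 'e::banach) set) (ultrapower_rel U)"
proof (rule equivI)
  let ?R = "ultrapower_rel U :: (('i \<Rightarrow> 'e) \<times> ('i \<Rightarrow> 'e)) set"
  have diff: "(\<lambda>i. x i - y i) \<in> bounded_families"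
    if "x \<in> bounded_families" "y \<in> bounded_families" for x y :: "'i \<Rightarrow> 'e"
    using bounded_minus_comp[of x UNIV y] that by (simp add: bounded_families_def)
  show "?R \<subseteq> bounded_families \<times> bounded_families"
    by (auto simp: ultrapower_rel_def)
  show "refl_on bounded_families (?R)"
    by (auto simp: refl_on_def ultrapower_rel_def null_families_def bounded_families_def)
  show "sym (?R)"
  proof (rule symI)
    fix x y :: "'i \<Rightarrow> 'e"
    assume "(x, y) \<in> ?R"
    then show "(y, x) \<in> ?R"
      using diff[of y x] by (simp add: ultrapower_rel_def null_families_def norm_minus_commute)
  qed
  show "trans (?R)"
  proof (rule transI)
    fix x y z :: "'i \<Rightarrow> 'e"
    assume xy: "(x, y) \<in> ?R" and yz: "(y, z) \<in> ?R"
    have "((\<lambda>i. x i - y i) \<longlongrightarrow> 0) U" "((\<lambda>i. y i - z i) \<longlongrightarrow> 0) U"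
      using xy yz by (simp_all add: ultrapower_rel_def null_families_def tendsto_norm_zero_iff)
    then have "((\<lambda>i. (x i - y i) + (y i - z i)) \<longlongrightarrow> 0 + 0) U"
      by (rule tendsto_add)
    then show "(x, z) \<in> ?R"
      using xy yz diff[of x z]
      by (simp add: ultrapower_rel_def null_families_def tendsto_norm_zero_iff)
  qed
qed


section \<open>Maps from the bidual into an ultrapower\<close>

definition linear_isometry_into_ultrapower ::
    "('k::real_or_complex \<Rightarrow> 'e::banach \<Rightarrow> 'e) \<Rightarrow> 'i filter \<Rightarrow>
      (('k, 'e) functional2 \<Rightarrow> ('i \<Rightarrow> 'e) set) \<Rightarrow> bool" where
  "linear_isometry_into_ultrapower s U K \<longleftrightarrow>
     K \<in> bidual s \<rightarrow> ultrapower U \<and>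
     (\<forall>\<Phi>\<in>bidual s. \<forall>\<Psi>\<in>bidual s. K (bidual_add \<Phi> \<Psi>) = ultrapower_add U (K \<Phi>) (K \<Psi>)) \<and>
     (\<forall>c. \<forall>\<Phi>\<in>bidual s. K (bidual_scale c \<Phi>) = ultrapower_scale s U c (K \<Phi>)) \<and>
     (\<forall>\<Phi>\<in>bidual s. ultrapower_norm U (K \<Phi>) = bidual_norm s \<Phi>)"

definition left_module_hom_into_ultrapower ::
    "('k::real_or_complex \<Rightarrow> 'e::banach \<Rightarrow> 'e) \<Rightarrow> ('a \<Rightarrow> 'e \<Rightarrow> 'e) \<Rightarrow> 'i filter \<Rightarrow>
      (('k, 'e) functional2 \<Rightarrow> ('i \<Rightarrow> 'e) set) \<Rightarrow> bool" where
  "left_module_hom_into_ultrapower s l U K \<longleftrightarrow>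
     (\<forall>a. \<forall>\<Phi>\<in>bidual s. K (bidual_lact s l a \<Phi>) = ultrapower_lact l U a (K \<Phi>))"

definition right_module_hom_into_ultrapower ::
    "('k::real_or_complex \<Rightarrow> 'e::banach \<Rightarrow> 'e) \<Rightarrow> ('e \<Rightarrow> 'a \<Rightarrow> 'e) \<Rightarrow> 'i filter \<Rightarrow>
      (('k, 'e) functional2 \<Rightarrow> ('i \<Rightarrow> 'e) set) \<Rightarrow> bool" where
  "right_module_hom_into_ultrapower s r U K \<longleftrightarrow>
     (\<forall>a. \<forall>\<Phi>\<in>bidual s. K (bidual_ract s r \<Phi> a) = ultrapower_ract r U (K \<Phi>) a)"

text \<open>HOL cannot quantify existentially over types, so the index set has to be chosen in advance:
  it consists of sets of functionals on the dual, of dual elements and of algebra elements,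
  together with a natural number.\<close>

type_synonym ('k, 'e, 'a) ultra_index =
  "('k, 'e) functional2 set \<times> ('e \<Rightarrow>\<^sub>L 'k) set \<times> 'a set \<times> nat"

end

theory Submission
  imports Defs "HOL-Library.Function_Algebras"
begin

text \<open>
  A family \<open>f\<close> of vectors indexed by the bidual, with \<open>norm (f \<Phi>) \<le> norm \<Phi>\<close>, is required to solve
  finitely many linear equations up to \<open>\<epsilon>\<close>: \<open>f (\<Phi> + \<Psi>) = f \<Phi> + f \<Psi>\<close>, \<open>f (c \<Phi>) = c f \<Phi>\<close>,
  \<open>f (\<kappa> x) = x\<close>, \<open>f (a \<Phi>) = a f \<Phi>\<close> and \<open>\<mu> (f \<Phi>) = \<Phi> \<mu>\<close>. Since \<open>f \<Phi> = \<Phi>\<close> solves all of them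
  in the bidual, and since the dominated families are a convex set whose support function is
  that of the corresponding set of families in the bidual, such an \<open>f\<close> exists by Hahn--Banach
  separation. An ultrapower only sees relations up to null families, so no exactly linear maps on
  finite-dimensional subspaces are needed: along an ultrafilter refining the finite sets of equations
  and \<open>\<epsilon> \<rightarrow> 0\<close>, the approximate solutions give \<open>K\<close>. It is contractive, and it is isometric
  because \<open>\<sigma>\<close> is contractive and \<open>\<sigma> \<circ> K\<close> is the identity.
\<close>

section \<open>Hahn--Banach separation\<close>

definition sublinear :: "('v::real_vector \<Rightarrow> real) \<Rightarrow> bool" where
  "sublinear p \<longleftrightarrow> (\<forall>x y. p (x + y) \<le> p x + p y) \<and> (\<forall>t x. 0 < t \<longrightarrow> p (t *\<^sub>R x) = t * p x)"

lemma sublinear_add: "sublinear p \<Longrightarrow> p (x + y) \<le> p x + p y"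
  by (simp add: sublinear_def)

lemma sublinear_scaleR: "sublinear p \<Longrightarrow> 0 < t \<Longrightarrow> p (t *\<^sub>R x) = t * p x"
  by (simp add: sublinear_def)

lemma sublinear_zero:
  assumes "sublinear p" shows "p 0 = 0"
  using sublinear_scaleR[OF assms, of 2 0] by simp

lemma sublinear_ge_minus: "sublinear p \<Longrightarrow> - p (- x) \<le> p x"
  using sublinear_add[of p x "- x"] sublinear_zero[of p] by simp

text \<open>The factor \<open>1 / t\<close> at \<open>t *\<^sub>R x\<close> yields the reverse
  inequality, so an infimum only needs the easy half of homogeneity.\<close>

lemma sublinearI:
  assumes "\<And>x y. p (x + y) \<le> p x + p y" and "\<And>t x. 0 < t \<Longrightarrow> p (t *\<^sub>R x) \<le> t * p x"
  shows "sublinear p"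
proof -
  have "p (t *\<^sub>R x) = t * p x" if t: "0 < t" for t x
    using assms(2)[OF t, of x] assms(2)[of "1 / t" "t *\<^sub>R x"] t by (simp add: field_simps)
  with assms(1) show ?thesis by (simp add: sublinear_def)
qed

text \<open>A minimal sublinear functional \<open>p\<close> is linear: for fixed \<open>y\<close>, the sublinear functional
  \<open>x \<mapsto> inf\<^sub>t (p (x + t y) - t p y)\<close> lies below \<open>p\<close>, and its value at \<open>-y\<close> is at most \<open>- p y\<close>.\<close>

lemma sublinear_minimal_linear:
  fixes p :: "'v::real_vector \<Rightarrow> real"
  assumes p: "sublinear p" and min: "\<And>q. sublinear q \<Longrightarrow> q \<le> p \<Longrightarrow> q = p"
  shows "linear p"
proof -
  have neg: "p (- y) = - p y" for y
  proof -
    define q where "q x = (INF t\<in>{0..}. p (x + t *\<^sub>R y) - t * p y)" for x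
    \<comment> \<open>The infimum is finite since \<open>t * p y = p (t *\<^sub>R y)\<close> is at
      most \<open>p (x + t *\<^sub>R y) + p (- x)\<close>; homogeneity is available for positive
      \<open>t\<close> only.\<close>
    have lower: "- p (- x) \<le> p (x + t *\<^sub>R y) - t * p y" if "0 \<le> t" for x t
    proof (cases "t = 0")
      case True
      then show ?thesis using sublinear_ge_minus[OF p, of x] by simp
    next
      case False
      then show ?thesis
        using sublinear_add[OF p, of "x + t *\<^sub>R y" "- x"] sublinear_scaleR[OF p, of t y] that
        by simp
    qed
    then have bdd: "bdd_below ((\<lambda>t. p (x + t *\<^sub>R y) - t * p y) ` {0..})" for x
      by (intro bdd_belowI2[of _ "- p (- x)"]) auto
    have q_le: "q x \<le> p (x + t *\<^sub>R y) - t * p y" if "0 \<le> t" for x t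
      unfolding q_def using that by (intro cINF_lower[OF bdd]) auto
    have "sublinear q"
    proof (rule sublinearI)
      fix x z
      \<comment> \<open>The parameters of the two infima add up to an admissible one at
        \<open>x + z\<close>; the infima are then taken one after the other.\<close>
      have "q (x + z) - (p (z + u *\<^sub>R y) - u * p y) \<le> q x" if u: "0 \<le> u" for u
        unfolding q_def[of x]
      proof (rule cINF_greatest)
        fix t :: real assume t: "t \<in> {0..}"
        have "q (x + z) \<le> p ((x + z) + (t + u) *\<^sub>R y) - (t + u) * p y"
          using t u by (intro q_le) auto
        also have "(x + z) + (t + u) *\<^sub>R y = (x + t *\<^sub>R y) + (z + u *\<^sub>R y)"
          by (simp add: algebra_simps)
        also have "p \<dots> \<le> p (x + t *\<^sub>R y) + p (z + u *\<^sub>R y)"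
          by (rule sublinear_add[OF p])
        finally show "q (x + z) - (p (z + u *\<^sub>R y) - u * p y) \<le> p (x + t *\<^sub>R y) - t * p y"
          by (simp add: algebra_simps)
      qed auto
      then have "q (x + z) - q x \<le> q z"
        unfolding q_def[of z] by (intro cINF_greatest) (auto simp: algebra_simps)
      then show "q (x + z) \<le> q x + q z" by simp
    next
      fix t :: real and x assume t: "0 < t"
      have "q (t *\<^sub>R x) / t \<le> q x"
        unfolding q_def[of x]
      proof (rule cINF_greatest)
        fix u :: real assume u: "u \<in> {0..}"
        have "q (t *\<^sub>R x) \<le> p (t *\<^sub>R x + (t * u) *\<^sub>R y) - (t * u) * p y"
          using t u by (intro q_le) auto
        also have "t *\<^sub>R x + (t * u) *\<^sub>R y = t *\<^sub>R (x + u *\<^sub>R y)"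
          by (simp add: algebra_simps)
        also have "p \<dots> = t * p (x + u *\<^sub>R y)" by (rule sublinear_scaleR[OF p t])
        finally show "q (t *\<^sub>R x) / t \<le> p (x + u *\<^sub>R y) - u * p y"
          using t by (simp add: field_simps)
      qed auto
      then show "q (t *\<^sub>R x) \<le> t * q x" using t by (simp add: field_simps)
    qed
    moreover have "q \<le> p"
      using q_le[of 0] by (simp add: le_fun_def)
    ultimately have "q = p" by (rule min)
    moreover have "q (- y) \<le> - p y"
      using q_le[of 1 "- y"] sublinear_zero[OF p] by simp
    ultimately have "p (- y) \<le> - p y" by simp
    with sublinear_ge_minus[OF p, of y] show ?thesis by simp
  qed
  show ?thesis
  proof (rule linearI)
    fix x y
    \<comment> \<open>Oddness turns subadditivity at \<open>- x\<close> and \<open>- y\<close> into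
      superadditivity at \<open>x\<close> and \<open>y\<close>.\<close>
    have "p (- x + - y) \<le> p (- x) + p (- y)" by (rule sublinear_add[OF p])
    then show "p (x + y) = p x + p y"
      using neg[of "x + y"] neg[of x] neg[of y] sublinear_add[OF p, of x y] by simp
  next
    fix t :: real and x
    consider "t = 0" | "0 < t" | "0 < - t" by linarith
    then show "p (t *\<^sub>R x) = t *\<^sub>R p x"
    proof cases
      case 1 then show ?thesis using sublinear_zero[OF p] by simp
    next
      case 2 then show ?thesis using sublinear_scaleR[OF p] by simp
    next
      case 3 then show ?thesis using sublinear_scaleR[OF p 3, of x] neg[of "t *\<^sub>R x"] by simp
    qed
  qed
qed

text \<open>Zorn's lemma for the reversed order gives a minimal sublinear functional below
  \<open>p\<close>, and minimal ones are linear. A nonempty chain is bounded below by its pointwise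
  infimum, which is finite because every member lies above \<open>- p (- x)\<close>.\<close>

theorem hahn_banach_sublinear:
  fixes p :: "'v::real_vector \<Rightarrow> real"
  assumes p: "sublinear p"
  obtains f where "linear f" and "f \<le> p"
proof -
  let ?A = "{q. sublinear q \<and> q \<le> p}"
  have "\<exists>m\<in>?A. \<forall>q\<in>?A. m \<ge> q \<longrightarrow> q = m"
  proof (rule predicate_Zorn)
    show "partial_order_on ?A (relation_of (\<lambda>q r. q \<ge> r) ?A)"
      by (rule partial_order_on_relation_ofI) auto
  next
    fix C assume "C \<in> Chains (relation_of (\<lambda>q r. q \<ge> r) ?A)"
    then have CA: "C \<subseteq> ?A" and total: "\<And>q r. q \<in> C \<Longrightarrow> r \<in> C \<Longrightarrow> q \<le> r \<or> r \<le> q"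
      unfolding Chains_def relation_of_def by blast+
    show "\<exists>u\<in>?A. \<forall>q\<in>C. q \<ge> u"
    proof (cases "C = {}")
      case True
      with p show ?thesis by auto
    next
      case False
      define u where "u x = (INF q\<in>C. q x)" for x
      have "- p (- x) \<le> q x" if "q \<in> C" for q x
      proof -
        have "q (- x) \<le> p (- x)" using that CA by (auto simp: le_fun_def)
        moreover have "- q (- x) \<le> q x" using that CA by (intro sublinear_ge_minus) auto
        ultimately show ?thesis by simp
      qed
      then have bdd: "bdd_below ((\<lambda>q. q x) ` C)" for x
        by (intro bdd_belowI2[of _ "- p (- x)"]) auto
      have u_le: "u x \<le> q x" if "q \<in> C" for q x
        unfolding u_def using that by (intro cINF_lower[OF bdd]) auto
      have "sublinear u"
      proof (rule sublinearI)
        fix x y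
        \<comment> \<open>Members of a chain are comparable, so the smaller of \<open>q\<close> and
          \<open>r\<close> serves at both points.\<close>
        have le: "u (x + y) \<le> q x + r y" if qr: "q \<in> C" "r \<in> C" for q r
        proof -
          obtain m where m: "m \<in> C" "m \<le> q" "m \<le> r" using total[OF qr] qr by auto
          have "u (x + y) \<le> m x + m y"
            using u_le[OF m(1), of "x + y"] sublinear_add[of m x y] m(1) CA by force
          then show ?thesis
            using le_funD[OF m(2), of x] le_funD[OF m(3), of y] by linarith
        qed
        have "u (x + y) - r y \<le> u x" if r: "r \<in> C" for r
          unfolding u_def[of x] using False le[OF _ r] by (intro cINF_greatest) (auto simp: algebra_simps)
        then have "u (x + y) - u x \<le> u y"
          unfolding u_def[of y] using False by (intro cINF_greatest) (auto simp: algebra_simps)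
        then show "u (x + y) \<le> u x + u y" by simp
      next
        fix t :: real and x assume t: "0 < t"
        have "u (t *\<^sub>R x) / t \<le> u x"
          unfolding u_def[of x]
        proof (rule cINF_greatest[OF False])
          fix q assume q: "q \<in> C"
          then have "q (t *\<^sub>R x) = t * q x" using CA t by (intro sublinear_scaleR) auto
          then show "u (t *\<^sub>R x) / t \<le> q x" using u_le[OF q, of "t *\<^sub>R x"] t by (simp add: field_simps)
        qed
        then show "u (t *\<^sub>R x) \<le> t * u x" using t by (simp add: field_simps)
      qed
      moreover have "u \<le> q" if "q \<in> C" for q
        using u_le[OF that] by (simp add: le_fun_def)
      moreover from this have "u \<le> p"
        using False CA by (blast intro: order_trans)
      ultimately show ?thesis by blast
    qed
  qed
  then obtain m where m: "sublinear m" "m \<le> p"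
    and min: "\<And>q. sublinear q \<Longrightarrow> q \<le> p \<Longrightarrow> q \<le> m \<Longrightarrow> q = m" by auto
  have "linear m"
    using m(2) min by (intro sublinear_minimal_linear[OF m(1)]) (auto intro: order_trans)
  with m(2) that show thesis by blast
qed

text \<open>The separating functional is dominated by \<open>w \<mapsto> inf (N (w + t s) - t \<epsilon>)\<close>, the infimum being
  over \<open>t \<ge> 0\<close> and \<open>s \<in> S\<close>.\<close>

theorem seminorm_separation:
  fixes N :: "'v::real_vector \<Rightarrow> real" and S :: "'v set"
  assumes N: "sublinear N" and even: "\<And>w. N (- w) = N w"
    and S: "convex S" "S \<noteq> {}" and far: "\<And>w. w \<in> S \<Longrightarrow> \<epsilon> \<le> N w"
  obtains f where "linear f" and "f \<le> N" and "\<And>w. w \<in> S \<Longrightarrow> \<epsilon> \<le> f w"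
proof -
  define P where "P w = (\<lambda>(t, s). N (w + t *\<^sub>R s) - t * \<epsilon>)" for w
  define A :: "(real \<times> 'v) set" where "A = {0..} \<times> S"
  define p where "p w = (INF a\<in>A. P w a)" for w
  have ne: "A \<noteq> {}" using S(2) by (auto simp: A_def)
  have nonneg: "0 \<le> N w" for w
    using sublinear_ge_minus[OF N, of w] even[of w] by simp
  \<comment> \<open>The distance of \<open>S\<close> from 0 pays for the term
    \<open>t * \<epsilon>\<close>, which keeps the infimum finite.\<close>
  have lower: "- N w \<le> P w a" if A: "a \<in> A" for w a
  proof -
    obtain t s where a: "a = (t, s)" "0 \<le> t" "s \<in> S" using A by (auto simp: A_def)
    have "t * \<epsilon> \<le> N (t *\<^sub>R s)"
    proof (cases "t = 0")
      case True then show ?thesis using nonneg by simp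
    next
      case False
      then show ?thesis using far[OF a(3)] a(2) sublinear_scaleR[OF N, of t s] by simp
    qed
    moreover have "N (t *\<^sub>R s) \<le> N (w + t *\<^sub>R s) + N (- w)"
      using sublinear_add[OF N, of "w + t *\<^sub>R s" "- w"] by simp
    ultimately show ?thesis by (simp add: P_def a even)
  qed
  then have bdd: "bdd_below (P w ` A)" for w
    by (intro bdd_belowI2[of _ "- N w"]) auto
  have p_le: "p w \<le> P w a" if "a \<in> A" for w a
    unfolding p_def using that by (intro cINF_lower[OF bdd])
  have "sublinear p"
  proof (rule sublinearI)
    fix w z
    have le: "p (w + z) \<le> P w a + P z b" if ab: "a \<in> A" "b \<in> A" for a b
    proof -
      obtain t s u r where a: "a = (t, s)" "0 \<le> t" "s \<in> S" and b: "b = (u, r)" "0 \<le> u" "r \<in> S"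
        using ab by (auto simp: A_def)
      \<comment> \<open>By convexity the combination is \<open>t + u\<close> times a point of
        \<open>S\<close>; if both parameters vanish, any point does.\<close>
      have "\<exists>q\<in>S. (t + u) *\<^sub>R q = t *\<^sub>R s + u *\<^sub>R r"
      proof (cases "t + u = 0")
        case True
        then have "t = 0" "u = 0" using a b by auto
        then show ?thesis using a by auto
      next
        case False
        then have "(t / (t + u)) *\<^sub>R s + (u / (t + u)) *\<^sub>R r \<in> S"
          using a b by (intro convexD[OF S(1)]) (auto simp: add_divide_distrib[symmetric])
        then show ?thesis
          using False by (intro bexI) (auto simp: scaleR_right_distrib)
      qed
      then obtain q where q: "q \<in> S" "(t + u) *\<^sub>R q = t *\<^sub>R s + u *\<^sub>R r" by blast
      have "p (w + z) \<le> P (w + z) (t + u, q)"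
        using q a b by (intro p_le) (auto simp: A_def)
      also have "\<dots> = N ((w + t *\<^sub>R s) + (z + u *\<^sub>R r)) - (t + u) * \<epsilon>"
      proof -
        have "(w + z) + (t + u) *\<^sub>R q = (w + t *\<^sub>R s) + (z + u *\<^sub>R r)"
          by (simp add: q(2))
        then show ?thesis by (simp only: P_def prod.case)
      qed
      also have "\<dots> \<le> P w a + P z b"
        using sublinear_add[OF N, of "w + t *\<^sub>R s" "z + u *\<^sub>R r"] by (simp add: P_def a b algebra_simps)
      finally show ?thesis .
    qed
    have "p (w + z) - P z b \<le> p w" if b: "b \<in> A" for b
      unfolding p_def[of w] using ne le[OF _ b] by (intro cINF_greatest) (auto simp: algebra_simps)
    then have "p (w + z) - p w \<le> p z"
      unfolding p_def[of z] using ne by (intro cINF_greatest) (auto simp: algebra_simps)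
    then show "p (w + z) \<le> p w + p z" by simp
  next
    fix t :: real and w assume t: "0 < t"
    have "p (t *\<^sub>R w) / t \<le> p w"
      unfolding p_def[of w]
    proof (rule cINF_greatest[OF ne])
      fix a assume "a \<in> A"
      then obtain u s where a: "a = (u, s)" "0 \<le> u" "s \<in> S" by (auto simp: A_def)
      have "p (t *\<^sub>R w) \<le> P (t *\<^sub>R w) (t * u, s)"
        using a t by (intro p_le) (auto simp: A_def)
      also have "\<dots> = N (t *\<^sub>R (w + u *\<^sub>R s)) - t * u * \<epsilon>"
        by (simp add: P_def algebra_simps)
      also have "\<dots> = t * P w a"
        by (simp only: P_def a sublinear_scaleR[OF N t] prod.case right_diff_distrib mult.assoc)
      finally show "p (t *\<^sub>R w) / t \<le> P w a" using t by (simp add: field_simps)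
    qed
    then show "p (t *\<^sub>R w) \<le> t * p w" using t by (simp add: field_simps)
  qed
  then obtain f where f: "linear f" "f \<le> p" by (rule hahn_banach_sublinear)
  obtain s0 where s0: "s0 \<in> S" using S(2) by blast
  have "f \<le> N"
  proof (rule le_funI)
    fix w
    have "f w \<le> P w (0, s0)"
      using f(2) p_le[of "(0, s0)" w] s0 by (auto simp: le_fun_def A_def intro: order_trans)
    then show "f w \<le> N w" by (simp add: P_def)
  qed
  moreover have "\<epsilon> \<le> f w" if w: "w \<in> S" for w
  proof -
    \<comment> \<open>At \<open>- w\<close> the parameters \<open>t = 1\<close> and
      \<open>s = w\<close> leave \<open>N 0 - \<epsilon>\<close>, that is,
      \<open>- \<epsilon>\<close>.\<close>
    have "f (- w) \<le> P (- w) (1, w)"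
      using f(2) p_le[of "(1, w)" "- w"] w by (auto simp: le_fun_def A_def intro: order_trans)
    then show ?thesis using linear_neg[OF f(1), of w] sublinear_zero[OF N] by (simp add: P_def)
  qed
  ultimately show thesis using that f(1) by blast
qed

section \<open>Families of vectors and functionals on them\<close>

instantiation "fun" :: (type, real_vector) real_vector
begin

definition scaleR_fun_def: "r *\<^sub>R f = (\<lambda>x. r *\<^sub>R f x)"

instance
  by standard (rule ext, simp add: scaleR_fun_def scaleR_add_right scaleR_add_left)+

end

lemma scaleR_fun_apply [simp]: "(r *\<^sub>R f) x = r *\<^sub>R f x"
  by (simp add: scaleR_fun_def)

text \<open>Used to split a functional on families into functionals of the single
  coordinates.\<close>

lemma sum_fun_single:
  assumes "finite R" "\<And>q. q \<notin> R \<Longrightarrow> w q = 0"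
  shows "(\<Sum>q\<in>R. (\<lambda>p. if p = q then w q else 0)) = (w :: 'q \<Rightarrow> 'e::comm_monoid_add)"
proof
  fix p
  have "(\<Sum>q\<in>R. (\<lambda>p. if p = q then w q else 0)) p = (\<Sum>q\<in>R. if p = q then w q else 0)"
    using assms(1) by (induction R rule: finite_induct) auto
  then show "(\<Sum>q\<in>R. (\<lambda>p. if p = q then w q else 0)) p = w p"
    using assms by simp
qed

text \<open>This is \<open>seminorm_separation\<close> for the sum of the norms over
  \<open>R\<close>. A functional dominated by this seminorm ignores the coordinates outside
  \<open>R\<close>, hence is a sum of coordinate functionals, each of norm at most 1.\<close>

corollary finite_family_separation:
  fixes S :: "('q \<Rightarrow> 'e::real_normed_vector) set"
  assumes "convex S" "S \<noteq> {}" and R: "finite R"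
    and "\<And>w. w \<in> S \<Longrightarrow> \<epsilon> \<le> (\<Sum>q\<in>R. norm (w q))"
  obtains F :: "'q \<Rightarrow> 'e \<Rightarrow> real"
  where "\<And>q. q \<in> R \<Longrightarrow> bounded_linear (F q)" and "\<And>w. w \<in> S \<Longrightarrow> \<epsilon> \<le> (\<Sum>q\<in>R. F q (w q))"
proof -
  define N :: "('q \<Rightarrow> 'e) \<Rightarrow> real" where "N w = (\<Sum>q\<in>R. norm (w q))" for w
  have "sublinear N"
  proof (rule sublinearI)
    show "N (x + y) \<le> N x + N y" for x y
      unfolding N_def sum.distrib[symmetric] by (intro sum_mono) (simp add: norm_triangle_ineq)
  qed (simp add: N_def sum_distrib_left)
  then obtain f where f: "linear f" "f \<le> N" "\<And>w. w \<in> S \<Longrightarrow> \<epsilon> \<le> f w"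
    by (rule seminorm_separation[of N S \<epsilon>]) (use assms in \<open>auto simp: N_def\<close>)
  define inj :: "'q \<Rightarrow> 'e \<Rightarrow> 'q \<Rightarrow> 'e" where "inj q x = (\<lambda>p. if p = q then x else 0)" for q x
  have abs_le: "\<bar>f w\<bar> \<le> N w" for w
  proof -
    have "f w \<le> N w" "f (- w) \<le> N (- w)" using f(2) by (simp_all add: le_fun_def)
    moreover have "N (- w) = N w" by (simp add: N_def)
    ultimately show ?thesis using linear_neg[OF f(1), of w] by simp
  qed
  have lin: "linear (\<lambda>x. f (inj q x))" for q
  proof (rule linearI)
    have "inj q (x + y) = inj q x + inj q y" for x y by (auto simp: inj_def)
    then show "f (inj q (x + y)) = f (inj q x) + f (inj q y)" for x y
      by (simp add: linear_add[OF f(1)])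
    have "inj q (t *\<^sub>R x) = t *\<^sub>R inj q x" for t x by (auto simp: inj_def)
    then show "f (inj q (t *\<^sub>R x)) = t *\<^sub>R f (inj q x)" for t x
      by (simp add: linear_scale[OF f(1)])
  qed
  have bl: "bounded_linear (\<lambda>x. f (inj q x))" if "q \<in> R" for q
  proof -
    have "N (inj q x) = norm x" for x
      using R that by (simp add: N_def inj_def if_distrib cong: if_cong)
    then have "\<bar>f (inj q x)\<bar> \<le> norm x * 1" for x
      using abs_le[of "inj q x"] by simp
    then show ?thesis
      using lin[of q] by (intro bounded_linear.intro bounded_linear_axioms.intro exI[of _ 1]) auto
  qed
  have f_eq: "f w = (\<Sum>q\<in>R. f (inj q (w q)))" for w
  proof -
    define v where "v p = (if p \<in> R then w p else 0)" for p
    have "f (w - v) = 0"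
      using abs_le[of "w - v"] by (simp add: N_def v_def)
    then have "f w = f v" by (simp add: linear_diff[OF f(1)])
    also have "v = (\<Sum>q\<in>R. inj q (v q))"
      unfolding inj_def by (rule sum_fun_single[OF R, symmetric]) (simp add: v_def)
    also have "\<dots> = (\<Sum>q\<in>R. inj q (w q))"
      by (rule sum.cong) (simp_all add: v_def)
    finally show ?thesis by (simp add: linear_sum[OF f(1)])
  qed
  have "\<epsilon> \<le> (\<Sum>q\<in>R. f (inj q (w q)))" if "w \<in> S" for w
    using f(3)[OF that] by (simp only: f_eq[of w])
  with bl show thesis by (rule that)
qed

section \<open>Ultrafilters\<close>

text \<open>Zorn's lemma gives a minimal proper filter below \<open>F\<close>. If its restriction to
  \<open>P\<close> is still proper, minimality makes it the same filter, so \<open>P\<close> holds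
  eventually; otherwise the negation of \<open>P\<close> does.\<close>

lemma ex_ultrafilter_le:
  assumes "F \<noteq> bot"
  obtains U where "U \<le> F" and "ultrafilter U"
proof -
  let ?A = "{G. G \<noteq> bot \<and> G \<le> F}"
  have "\<exists>m\<in>?A. \<forall>G\<in>?A. m \<ge> G \<longrightarrow> G = m"
  proof (rule predicate_Zorn)
    show "partial_order_on ?A (relation_of (\<lambda>G H. G \<ge> H) ?A)"
      by (rule partial_order_on_relation_ofI) auto
  next
    fix C assume "C \<in> Chains (relation_of (\<lambda>G H. G \<ge> H) ?A)"
    then have CA: "C \<subseteq> ?A" and total: "\<And>G H. G \<in> C \<Longrightarrow> H \<in> C \<Longrightarrow> G \<le> H \<or> H \<le> G"
      unfolding Chains_def relation_of_def by blast+
    show "\<exists>u\<in>?A. \<forall>G\<in>C. G \<ge> u"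
    proof (cases "C = {}")
      case True
      with assms show ?thesis by auto
    next
      case False
      \<comment> \<open>The infimum of a nonempty chain has as events exactly those of its members,
        so it stays proper.\<close>
      have "eventually P (Inf C) \<longleftrightarrow> (\<exists>G\<in>C. eventually P G)" for P
      proof (rule eventually_Inf_base[OF False])
        fix G H assume GH: "G \<in> C" "H \<in> C"
        with total[OF GH] show "\<exists>x\<in>C. x \<le> inf G H"
          by (metis inf.absorb1 inf.absorb2 order_refl)
      qed
      then have "Inf C \<noteq> bot" using CA by (auto simp: trivial_limit_def)
      moreover have "Inf C \<le> F" using False CA by (auto intro: Inf_lower2)
      ultimately show ?thesis by (auto intro: Inf_lower)
    qed
  qed
  then obtain U where U: "U \<noteq> bot" "U \<le> F" and min: "\<And>G. G \<noteq> bot \<Longrightarrow> G \<le> U \<Longrightarrow> G = U"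
    by (auto intro: order_trans)
  have "eventually P U \<or> eventually (\<lambda>i. \<not> P i) U" for P
  proof (cases "inf U (principal {i. P i}) = bot")
    case True
    then have "eventually (\<lambda>i. \<not> P i) U"
      by (simp add: trivial_limit_def eventually_inf_principal)
    then show ?thesis ..
  next
    case False
    then have "inf U (principal {i. P i}) = U" by (intro min) auto
    moreover have "eventually P (inf U (principal {i. P i}))"
      by (simp add: eventually_inf_principal)
    ultimately show ?thesis by simp
  qed
  with U that show thesis by (auto simp: ultrafilter_def)
qed

section \<open>Scalars and real functionals\<close>

text \<open>The class only asserts that an embedding exists; fixing one makes real and imaginary
  parts of scalars available.\<close>

definition scalar_embedding :: "'k::real_or_complex \<Rightarrow> complex" where
  "scalar_embedding = (SOME h. (\<forall>x y. h (x + y) = h x + h y) \<and> (\<forall>x y. h (x * y) = h x * h y) \<and>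
     (\<forall>r x. h (r *\<^sub>R x) = r *\<^sub>R h x) \<and> (\<forall>x. norm (h x) = norm x) \<and>
     (range h = \<real> \<or> range h = UNIV))"

lemma
  fixes x y :: "'k::real_or_complex"
  shows scalar_embedding_add: "scalar_embedding (x + y) = scalar_embedding x + scalar_embedding y"
    and scalar_embedding_mult: "scalar_embedding (x * y) = scalar_embedding x * scalar_embedding y"
    and scalar_embedding_scaleR: "scalar_embedding (r *\<^sub>R x) = r *\<^sub>R scalar_embedding x"
    and norm_scalar_embedding: "norm (scalar_embedding x) = norm x"
    and range_scalar_embedding: "range (scalar_embedding :: 'k \<Rightarrow> complex) = \<real> \<or>
      range (scalar_embedding :: 'k \<Rightarrow> complex) = UNIV"
  using someI_ex[OF real_or_complex_embedding[where 'a='k]]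
  unfolding scalar_embedding_def[symmetric] by blast+

lemma linear_scalar_embedding: "linear scalar_embedding"
  by (rule linearI) (simp_all add: scalar_embedding_add scalar_embedding_scaleR)

lemma inj_scalar_embedding: "inj scalar_embedding"
proof (rule injI)
  fix x y :: "'a::real_or_complex"
  assume "scalar_embedding x = scalar_embedding y"
  then have "norm (x - y) = 0"
    using norm_scalar_embedding[of "x - y"] by (simp add: linear_diff[OF linear_scalar_embedding])
  then show "x = y" by simp
qed

text \<open>The image of \<open>1\<close> is a nonzero idempotent of the complex field, hence 1;
  real linearity does the rest.\<close>

lemma scalar_embedding_of_real: "scalar_embedding (of_real r) = of_real r"
proof -
  have "scalar_embedding (1::'a) * scalar_embedding (1::'a) = scalar_embedding (1::'a)"
    by (simp flip: scalar_embedding_mult)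
  moreover have "scalar_embedding (1::'a) \<noteq> 0"
    using norm_scalar_embedding[of "1::'a"] by auto
  ultimately have "scalar_embedding (1::'a) = 1" by simp
  then show ?thesis
    by (simp add: of_real_def scalar_embedding_scaleR)
qed

definition real_part :: "'k::real_or_complex \<Rightarrow> real" where
  "real_part c = Re (scalar_embedding c)"

lemma linear_real_part: "linear real_part"
  unfolding real_part_def
  by (rule linearI) (simp_all add: scalar_embedding_add scalar_embedding_scaleR)

lemma real_part_of_real [simp]: "real_part (of_real r) = r"
  by (simp add: real_part_def scalar_embedding_of_real)

lemma real_part_le_norm: "real_part c \<le> norm c"
  using complex_Re_le_cmod[of "scalar_embedding c"] by (simp add: real_part_def norm_scalar_embedding)

context banach_space_over
begin

lemma bounded_linear_scale: "bounded_linear (s c)"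
proof (rule bounded_linear_intro[where K = "norm c"])
  show "s c (r *\<^sub>R x) = r *\<^sub>R s c x" for r x
    by (metis mult.commute scale_of_real scale_scale)
qed (simp_all add: scale_right_distrib norm_scale)

lemma dual_apply_scale: "\<mu> \<in> dual s \<Longrightarrow> blinfun_apply \<mu> (s c x) = c * blinfun_apply \<mu> x"
  by (simp add: dual_def)

text \<open>Over the complex field the lift of \<open>g\<close> is \<open>x \<mapsto> g x - \<i> g (\<i> x)\<close>.\<close>

lemma real_functional_lift:
  assumes g: "bounded_linear (g :: 'e \<Rightarrow> real)"
  obtains \<mu> where "\<mu> \<in> dual s" and "\<And>x. real_part (blinfun_apply \<mu> x) = g x"
proof (cases "range (scalar_embedding :: 'k \<Rightarrow> complex) = \<real>")
  case True
  \<comment> \<open>Every scalar is real here, so \<open>g\<close> followed by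
    \<open>of_real\<close> is already linear over the field.\<close>
  have c_eq: "c = of_real (real_part c)" for c :: 'k
  proof -
    have "scalar_embedding c \<in> \<real>" using True by blast
    then have "scalar_embedding c = of_real (real_part c)"
      by (simp add: real_part_def of_real_Re)
    then have "scalar_embedding c = scalar_embedding (of_real (real_part c) :: 'k)"
      by (simp add: scalar_embedding_of_real)
    then show ?thesis using inj_scalar_embedding by (auto dest: injD)
  qed
  have bl: "bounded_linear (\<lambda>x. of_real (g x) :: 'k)"
    by (rule bounded_linear_compose[OF bounded_linear_of_real g])
  have "of_real (g (s c x)) = c * of_real (g x)" for c x
    using scale_of_real[of "real_part c" x] linear_scale[OF bounded_linear.linear[OF g]]
    by (subst (1 2) c_eq) (simp only: real_scaleR_def of_real_mult)
  with bl show ?thesis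
    by (intro that[of "Blinfun (\<lambda>x. of_real (g x))"])
       (simp_all add: dual_def bounded_linear_Blinfun_apply)
next
  case False
  then have "range (scalar_embedding :: 'k \<Rightarrow> complex) = UNIV"
    using range_scalar_embedding[where 'k='k] by blast
  then obtain j :: 'k where j: "scalar_embedding j = \<i>" by (metis UNIV_I imageE)
  have "scalar_embedding (j * j) = scalar_embedding (of_real (- 1) :: 'k)"
    by (simp only: scalar_embedding_of_real scalar_embedding_mult j) simp
  then have jj: "j * j = - 1" using inj_scalar_embedding by (auto dest: injD)
  define b where "b c = Im (scalar_embedding c)" for c :: 'k
  have c_eq: "c = of_real (real_part c) + of_real (b c) * j" for c :: 'k
  proof -
    have "scalar_embedding c = scalar_embedding (of_real (real_part c) + of_real (b c) * j)"
      by (simp add: scalar_embedding_add scalar_embedding_mult scalar_embedding_of_real j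
          real_part_def b_def complex_eq_iff)
    then show ?thesis using inj_scalar_embedding by (auto dest: injD)
  qed
  define \<mu> where "\<mu> x = of_real (g x) - j * of_real (g (s j x))" for x
  have bl: "bounded_linear \<mu>"
    unfolding \<mu>_def
    by (intro bounded_linear_sub bounded_linear_compose[OF bounded_linear_mult_right]
        bounded_linear_compose[OF bounded_linear_of_real] bounded_linear_compose[OF g]
        bounded_linear_scale bounded_linear_ident)
  have of_r: "\<mu> (s (of_real r) x) = of_real r * \<mu> x" for r x
    using linear_scale[OF bounded_linear.linear[OF bl], of r x] by (simp add: scale_of_real scaleR_conv_of_real)
  have mult_j: "\<mu> (s j x) = j * \<mu> x" for x
  proof -
    have "s j (s j x) = - x" using jj by simp
    then have "\<mu> (s j x) = of_real (g (s j x)) + j * of_real (g x)"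
      by (simp add: \<mu>_def linear_neg[OF bounded_linear.linear[OF g]])
    also have "\<dots> = j * of_real (g x) - (j * j) * of_real (g (s j x))" by (simp add: jj)
    also have "\<dots> = j * \<mu> x" by (simp add: \<mu>_def algebra_simps)
    finally show ?thesis .
  qed
  have mult: "\<mu> (s c x) = c * \<mu> x" for c x
  proof -
    have "s c x = s (of_real (real_part c)) x + s (of_real (b c)) (s j x)"
      by (subst c_eq) (simp only: scale_left_distrib scale_scale)
    then have "\<mu> (s c x) = (of_real (real_part c) + of_real (b c) * j) * \<mu> x"
      by (simp only: linear_add[OF bounded_linear.linear[OF bl]] of_r mult_j distrib_right mult.assoc)
    then show ?thesis by (simp only: c_eq[symmetric])
  qed
  have "real_part (\<mu> x) = g x" for x
    by (simp add: \<mu>_def linear_diff[OF linear_real_part])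
      (simp add: real_part_def scalar_embedding_mult scalar_embedding_of_real j)
  with mult bl show ?thesis
    by (intro that[of "Blinfun \<mu>"]) (simp_all add: dual_def bounded_linear_Blinfun_apply)
qed

section \<open>The bidual\<close>

lemma dual_zero: "0 \<in> dual s"
  and dual_add: "\<mu> \<in> dual s \<Longrightarrow> \<nu> \<in> dual s \<Longrightarrow> \<mu> + \<nu> \<in> dual s"
  and dual_minus: "\<mu> \<in> dual s \<Longrightarrow> - \<mu> \<in> dual s"
  by (simp_all add: dual_def blinfun.bilinear_simps algebra_simps)

lemma dual_scale_apply: "blinfun_apply (dual_scale c \<mu>) x = c * blinfun_apply \<mu> x"
  by (simp add: dual_scale_def)

lemma dual_scale_in_dual: "\<mu> \<in> dual s \<Longrightarrow> dual_scale c \<mu> \<in> dual s"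
  by (simp add: dual_def dual_scale_apply)

lemma bidual_apply_add: "\<Phi> \<in> bidual s \<Longrightarrow> \<mu> \<in> dual s \<Longrightarrow> \<nu> \<in> dual s \<Longrightarrow> \<Phi> (\<mu> + \<nu>) = \<Phi> \<mu> + \<Phi> \<nu>"
  by (simp add: bidual_def)

lemma bidual_apply_scale: "\<Phi> \<in> bidual s \<Longrightarrow> \<mu> \<in> dual s \<Longrightarrow> \<Phi> (dual_scale c \<mu>) = c * \<Phi> \<mu>"
  by (simp add: bidual_def)

lemma bidual_apply_zero: "\<Phi> \<in> bidual s \<Longrightarrow> \<Phi> 0 = 0"
  using bidual_apply_add[of \<Phi> 0 0] dual_zero by simp

lemma bidual_apply_minus: "\<Phi> \<in> bidual s \<Longrightarrow> \<mu> \<in> dual s \<Longrightarrow> \<Phi> (- \<mu>) = - \<Phi> \<mu>"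
  using bidual_apply_add[of \<Phi> \<mu> "- \<mu>"] dual_minus[of \<mu>] bidual_apply_zero[of \<Phi>]
  by (simp add: eq_neg_iff_add_eq_0 add.commute)

lemma bidual_off_dual: "\<Phi> \<in> bidual s \<Longrightarrow> \<mu> \<notin> dual s \<Longrightarrow> \<Phi> \<mu> = 0"
  by (simp add: bidual_def)

text \<open>The supremum in \<open>bidual_norm\<close> can only be estimated once its values are
  known to be bounded. The absolute value guards against a negative \<open>C\<close>.\<close>

lemma bidual_bdd_above:
  assumes "\<Phi> \<in> bidual s"
  shows "bdd_above ((\<lambda>\<mu>. norm (\<Phi> \<mu>)) ` {\<mu> \<in> dual s. norm \<mu> \<le> 1})"
proof -
  obtain C where C: "\<And>\<mu>. \<mu> \<in> dual s \<Longrightarrow> norm (\<Phi> \<mu>) \<le> C * norm \<mu>"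
    using assms unfolding bidual_def by blast
  have "norm (\<Phi> \<mu>) \<le> \<bar>C\<bar>" if "\<mu> \<in> dual s" "norm \<mu> \<le> 1" for \<mu>
  proof -
    have "C * norm \<mu> \<le> \<bar>C\<bar> * 1" using that by (intro mult_mono) auto
    with C[OF that(1)] show ?thesis by simp
  qed
  then show ?thesis by (intro bdd_aboveI2[of _ _ "\<bar>C\<bar>"]) auto
qed

lemma norm_apply_le_bidual_norm:
  assumes \<Phi>: "\<Phi> \<in> bidual s" and \<mu>: "\<mu> \<in> dual s"
  shows "norm (\<Phi> \<mu>) \<le> bidual_norm s \<Phi> * norm \<mu>"
proof (cases "\<mu> = 0")
  case True
  then show ?thesis using bidual_apply_zero[OF \<Phi>] by simp
next
  case False
  define \<nu> where "\<nu> = dual_scale (of_real (1 / norm \<mu>)) \<mu>"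
  have "\<nu> = (1 / norm \<mu>) *\<^sub>R \<mu>"
    by (rule blinfun_eqI) (simp add: \<nu>_def dual_scale_apply blinfun.scaleR_left scaleR_conv_of_real)
  then have "norm \<nu> \<le> 1" using False by simp
  moreover have "\<nu> \<in> dual s" using \<mu> by (simp add: \<nu>_def dual_scale_in_dual)
  ultimately have "norm (\<Phi> \<nu>) \<le> bidual_norm s \<Phi>"
    unfolding bidual_norm_def by (intro cSUP_upper[OF _ bidual_bdd_above[OF \<Phi>]]) auto
  moreover have "norm (\<Phi> \<nu>) = norm (\<Phi> \<mu>) / norm \<mu>"
    using \<Phi> \<mu> False by (simp add: \<nu>_def bidual_apply_scale norm_mult norm_divide)
  ultimately show ?thesis using False by (simp add: field_simps)
qed

lemma bidual_norm_nonneg: "\<Phi> \<in> bidual s \<Longrightarrow> 0 \<le> bidual_norm s \<Phi>"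
  unfolding bidual_norm_def
  by (rule cSUP_upper2[OF bidual_bdd_above, of _ 0]) (auto simp: dual_zero)

lemma bidualI:
  assumes "\<And>\<mu>. \<mu> \<notin> dual s \<Longrightarrow> \<Phi> \<mu> = 0"
    and "\<And>\<mu> \<nu>. \<mu> \<in> dual s \<Longrightarrow> \<nu> \<in> dual s \<Longrightarrow> \<Phi> (\<mu> + \<nu>) = \<Phi> \<mu> + \<Phi> \<nu>"
    and "\<And>c \<mu>. \<mu> \<in> dual s \<Longrightarrow> \<Phi> (dual_scale c \<mu>) = c * \<Phi> \<mu>"
    and "\<And>\<mu>. \<mu> \<in> dual s \<Longrightarrow> norm (\<Phi> \<mu>) \<le> C * norm \<mu>"
  shows "\<Phi> \<in> bidual s"
  using assms unfolding bidual_def by blast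

lemma bidual_add_in_bidual:
  assumes "\<Phi> \<in> bidual s" "\<Psi> \<in> bidual s"
  shows "bidual_add \<Phi> \<Psi> \<in> bidual s"
proof -
  have "norm (bidual_add \<Phi> \<Psi> \<mu>) \<le> (bidual_norm s \<Phi> + bidual_norm s \<Psi>) * norm \<mu>"
    if "\<mu> \<in> dual s" for \<mu>
    using norm_apply_le_bidual_norm[OF assms(1) that] norm_apply_le_bidual_norm[OF assms(2) that]
      norm_triangle_ineq[of "\<Phi> \<mu>" "\<Psi> \<mu>"] by (simp add: bidual_add_def algebra_simps)
  then show ?thesis
    by (rule bidualI[rotated -1])
      (use assms in \<open>auto simp: bidual_add_def bidual_off_dual bidual_apply_add bidual_apply_scale
        dual_add dual_scale_in_dual algebra_simps\<close>)
qed

lemma bidual_scale_in_bidual: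
  assumes "\<Phi> \<in> bidual s"
  shows "bidual_scale c \<Phi> \<in> bidual s"
proof -
  have "norm (bidual_scale c \<Phi> \<mu>) \<le> (norm c * bidual_norm s \<Phi>) * norm \<mu>" if "\<mu> \<in> dual s" for \<mu>
    using norm_apply_le_bidual_norm[OF assms that]
    by (simp add: bidual_scale_def norm_mult mult.assoc mult_left_mono)
  then show ?thesis
    by (rule bidualI[rotated -1])
      (use assms in \<open>auto simp: bidual_scale_def bidual_off_dual bidual_apply_add bidual_apply_scale
        dual_add dual_scale_in_dual algebra_simps\<close>)
qed

lemma canonical_embedding_in_bidual: "canonical_embedding s x \<in> bidual s"
proof -
  have "norm (canonical_embedding s x \<mu>) \<le> norm x * norm \<mu>" if "\<mu> \<in> dual s" for \<mu>
    using norm_blinfun[of \<mu> x] that by (simp add: canonical_embedding_def mult.commute)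
  then show ?thesis
    by (rule bidualI[rotated -1])
      (auto simp: canonical_embedding_def dual_add dual_scale_in_dual dual_scale_apply blinfun.add_left)
qed

text \<open>Separating the one-point set of \<open>x - y\<close> from 0, with \<open>unit\<close> as
  index type, and lifting the real functional gives a dual element that tells \<open>x\<close> and
  \<open>y\<close> apart.\<close>

lemma inj_canonical_embedding: "inj (canonical_embedding s)"
proof (rule injI)
  fix x y assume eq: "canonical_embedding s x = canonical_embedding s y"
  obtain F :: "unit \<Rightarrow> 'e \<Rightarrow> real" where F: "bounded_linear (F ())" "norm (x - y) \<le> F () (x - y)"
    by (rule finite_family_separation[of "{\<lambda>_. x - y}" "{()}" "norm (x - y)"]) auto
  obtain \<mu> where \<mu>: "\<mu> \<in> dual s" "\<And>z. real_part (blinfun_apply \<mu> z) = F () z"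
    using real_functional_lift[OF F(1)] by blast
  have "blinfun_apply \<mu> x = blinfun_apply \<mu> y"
    using fun_cong[OF eq, of \<mu>] \<mu>(1) by (simp add: canonical_embedding_def)
  then have "F () (x - y) = 0"
    using \<mu>(2)[of x] \<mu>(2)[of y] linear_diff[OF bounded_linear.linear[OF F(1)], of x y] by simp
  with F(2) show "x = y" by simp
qed

text \<open>The common form of a left action and of a right action with its arguments exchanged, so
  that one construction serves all kinds of modules.\<close>

definition operator_family :: "('c \<Rightarrow> 'e \<Rightarrow> 'e) \<Rightarrow> bool" where
  "operator_family T \<longleftrightarrow> (\<forall>a. bounded_linear (T a) \<and> (\<forall>c x. T a (s c x) = s c (T a x)))"

lemma dual_ract_apply:
  assumes "operator_family T"
  shows "blinfun_apply (dual_ract T \<mu> a) x = blinfun_apply \<mu> (T a x)"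
  unfolding dual_ract_def using assms
  by (subst bounded_linear_Blinfun_apply)
    (auto simp: operator_family_def intro: bounded_linear_compose[OF blinfun.bounded_linear_right])

lemma dual_ract_in_dual: "operator_family T \<Longrightarrow> \<mu> \<in> dual s \<Longrightarrow> dual_ract T \<mu> a \<in> dual s"
  by (simp add: dual_def dual_ract_apply) (simp add: operator_family_def)

text \<open>The new functional is \<Phi> composed with the adjoint of \<open>T a\<close>, and that
  adjoint is bounded by \<open>onorm (T a)\<close>.\<close>

lemma bidual_lact_in_bidual:
  assumes T: "operator_family T" and \<Phi>: "\<Phi> \<in> bidual s"
  shows "bidual_lact s T a \<Phi> \<in> bidual s"
proof -
  have bl: "bounded_linear (T a)" using T by (simp add: operator_family_def)
  have bound: "norm (bidual_lact s T a \<Phi> \<mu>) \<le> (bidual_norm s \<Phi> * onorm (T a)) * norm \<mu>"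
    if \<mu>: "\<mu> \<in> dual s" for \<mu>
  proof -
    have "norm (dual_ract T \<mu> a) \<le> norm \<mu> * onorm (T a)"
    proof (rule norm_blinfun_bound)
      show "0 \<le> norm \<mu> * onorm (T a)" using onorm_pos_le[OF bl] by simp
      show "norm (blinfun_apply (dual_ract T \<mu> a) x) \<le> norm \<mu> * onorm (T a) * norm x" for x
        using norm_blinfun[of \<mu> "T a x"] mult_left_mono[OF onorm[OF bl, of x] norm_ge_zero[of \<mu>]]
        by (simp add: dual_ract_apply[OF T] mult.assoc)
    qed
    then have "bidual_norm s \<Phi> * norm (dual_ract T \<mu> a) \<le> bidual_norm s \<Phi> * (norm \<mu> * onorm (T a))"
      using bidual_norm_nonneg[OF \<Phi>] by (rule mult_left_mono)
    with norm_apply_le_bidual_norm[OF \<Phi> dual_ract_in_dual[OF T \<mu>]] \<mu> show ?thesis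
      by (simp add: bidual_lact_def algebra_simps) (meson order_trans)
  qed
  have "dual_ract T (\<mu> + \<nu>) a = dual_ract T \<mu> a + dual_ract T \<nu> a" for \<mu> \<nu> :: "'e \<Rightarrow>\<^sub>L 'k"
    by (rule blinfun_eqI) (simp add: dual_ract_apply[OF T] blinfun.add_left)
  moreover have "dual_ract T (dual_scale c \<mu>) a = dual_scale c (dual_ract T \<mu> a)"
    for c and \<mu> :: "'e \<Rightarrow>\<^sub>L 'k"
    by (rule blinfun_eqI) (simp add: dual_ract_apply[OF T] dual_scale_apply)
  ultimately show ?thesis
    using bound \<Phi>
    by (intro bidualI[of _ "bidual_norm s \<Phi> * onorm (T a)"])
      (auto simp: bidual_lact_def dual_add dual_scale_in_dual dual_ract_in_dual[OF T]
        bidual_apply_add bidual_apply_scale)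
qed

section \<open>Local reflexivity for finitely many linear relations\<close>

text \<open>A functional \<open>g\<close> on families \<open>f\<close> of vectors indexed by the bidual that only involves
  dual elements applied to finitely many \<open>f \<Phi>\<close> also makes sense at the identity family
  \<open>\<Phi> \<mapsto> \<Phi>\<close>, where its value is \<open>v\<close>.\<close>

definition value_at_identity :: "((('k, 'e) functional2 \<Rightarrow> 'e) \<Rightarrow> 'k) \<Rightarrow> 'k \<Rightarrow> bool" where
  "value_at_identity g v \<longleftrightarrow> (\<exists>J \<nu>. finite J \<and> J \<subseteq> bidual s \<and> (\<forall>\<Phi>\<in>J. \<nu> \<Phi> \<in> dual s) \<and>
     (\<forall>f. g f = (\<Sum>\<Phi>\<in>J. blinfun_apply (\<nu> \<Phi>) (f \<Phi>))) \<and> v = (\<Sum>\<Phi>\<in>J. \<Phi> (\<nu> \<Phi>)))"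

lemma value_at_identity_zero: "value_at_identity (\<lambda>f. 0) 0"
  unfolding value_at_identity_def by (intro exI[of _ "{}"]) auto

lemma value_at_identity_eval:
  "\<Phi> \<in> bidual s \<Longrightarrow> \<mu> \<in> dual s \<Longrightarrow> value_at_identity (\<lambda>f. blinfun_apply \<mu> (f \<Phi>)) (\<Phi> \<mu>)"
  unfolding value_at_identity_def by (intro exI[of _ "{\<Phi>}"] exI[of _ "\<lambda>_. \<mu>"]) auto

lemma value_at_identity_minus:
  assumes "value_at_identity g v"
  shows "value_at_identity (\<lambda>f. - g f) (- v)"
proof -
  obtain J \<nu> where J: "finite J" "J \<subseteq> bidual s" "\<And>\<Phi>. \<Phi> \<in> J \<Longrightarrow> \<nu> \<Phi> \<in> dual s"
    "\<And>f. g f = (\<Sum>\<Phi>\<in>J. blinfun_apply (\<nu> \<Phi>) (f \<Phi>))" "v = (\<Sum>\<Phi>\<in>J. \<Phi> (\<nu> \<Phi>))"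
    using assms by (auto simp: value_at_identity_def)
  have "- v = (\<Sum>\<Phi>\<in>J. \<Phi> (- \<nu> \<Phi>))"
    unfolding J(5) sum_negf[symmetric]
    by (rule sum.cong) (use J(2,3) in \<open>auto simp: bidual_apply_minus\<close>)
  then show ?thesis
    unfolding value_at_identity_def
    by (intro exI[of _ J] exI[of _ "\<lambda>\<Phi>. - \<nu> \<Phi>"])
      (use J in \<open>auto simp: dual_minus blinfun.minus_left sum_negf\<close>)
qed

text \<open>Extending both families of dual elements by 0 allows summation over the union of the
  index sets.\<close>

lemma value_at_identity_add:
  assumes "value_at_identity g v" and "value_at_identity h w"
  shows "value_at_identity (\<lambda>f. g f + h f) (v + w)"
proof -
  obtain J \<nu> where J: "finite J" "J \<subseteq> bidual s" "\<And>\<Phi>. \<Phi> \<in> J \<Longrightarrow> \<nu> \<Phi> \<in> dual s"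
    "\<And>f. g f = (\<Sum>\<Phi>\<in>J. blinfun_apply (\<nu> \<Phi>) (f \<Phi>))" "v = (\<Sum>\<Phi>\<in>J. \<Phi> (\<nu> \<Phi>))"
    using assms(1) by (auto simp: value_at_identity_def)
  obtain I \<kappa> where I: "finite I" "I \<subseteq> bidual s" "\<And>\<Phi>. \<Phi> \<in> I \<Longrightarrow> \<kappa> \<Phi> \<in> dual s"
    "\<And>f. h f = (\<Sum>\<Phi>\<in>I. blinfun_apply (\<kappa> \<Phi>) (f \<Phi>))" "w = (\<Sum>\<Phi>\<in>I. \<Phi> (\<kappa> \<Phi>))"
    using assms(2) by (auto simp: value_at_identity_def)
  define \<nu>' where "\<nu>' \<Phi> = (if \<Phi> \<in> J then \<nu> \<Phi> else 0)" for \<Phi>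
  define \<kappa>' where "\<kappa>' \<Phi> = (if \<Phi> \<in> I then \<kappa> \<Phi> else 0)" for \<Phi>
  have dual: "\<nu>' \<Phi> \<in> dual s" "\<kappa>' \<Phi> \<in> dual s" for \<Phi>
    using J(3) I(3) dual_zero by (auto simp: \<nu>'_def \<kappa>'_def)
  have "g f = (\<Sum>\<Phi>\<in>J \<union> I. blinfun_apply (\<nu>' \<Phi>) (f \<Phi>))" for f
    unfolding J(4) by (rule sum.mono_neutral_cong_left) (use J I in \<open>auto simp: \<nu>'_def\<close>)
  moreover have "h f = (\<Sum>\<Phi>\<in>J \<union> I. blinfun_apply (\<kappa>' \<Phi>) (f \<Phi>))" for f
    unfolding I(4) by (rule sum.mono_neutral_cong_left) (use J I in \<open>auto simp: \<kappa>'_def\<close>)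
  moreover have "v = (\<Sum>\<Phi>\<in>J \<union> I. \<Phi> (\<nu>' \<Phi>))"
    unfolding J(5)
    by (rule sum.mono_neutral_cong_left) (use J I in \<open>auto simp: \<nu>'_def bidual_apply_zero\<close>)
  moreover have "w = (\<Sum>\<Phi>\<in>J \<union> I. \<Phi> (\<kappa>' \<Phi>))"
    unfolding I(5)
    by (rule sum.mono_neutral_cong_left) (use J I in \<open>auto simp: \<kappa>'_def bidual_apply_zero\<close>)
  moreover have "(\<Sum>\<Phi>\<in>J \<union> I. \<Phi> (\<nu>' \<Phi> + \<kappa>' \<Phi>)) = (\<Sum>\<Phi>\<in>J \<union> I. \<Phi> (\<nu>' \<Phi>) + \<Phi> (\<kappa>' \<Phi>))"
    by (rule sum.cong) (use J(2) I(2) dual in \<open>auto simp: bidual_apply_add\<close>)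
  ultimately show ?thesis
    unfolding value_at_identity_def using J(1,2) I(1,2) dual
    by (intro exI[of _ "J \<union> I"] exI[of _ "\<lambda>\<Phi>. \<nu>' \<Phi> + \<kappa>' \<Phi>"])
      (auto simp: dual_add blinfun.add_left sum.distrib)
qed

lemma value_at_identity_diff:
  "value_at_identity g v \<Longrightarrow> value_at_identity h w \<Longrightarrow> value_at_identity (\<lambda>f. g f - h f) (v - w)"
  using value_at_identity_add[OF _ value_at_identity_minus] by force

lemma value_at_identity_sum:
  assumes "finite R" and "\<And>q. q \<in> R \<Longrightarrow> value_at_identity (g q) (v q)"
  shows "value_at_identity (\<lambda>f. \<Sum>q\<in>R. g q f) (\<Sum>q\<in>R. v q)"
  using assms
  by (induction R rule: finite_induct) (simp_all add: value_at_identity_zero value_at_identity_add)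

text \<open>A Goldstine argument for a single \<mu>. If its real part stayed below \<open>r\<close>
  on the ball whose radius is the norm \<open>b\<close> of \<Phi>, then so would its modulus, whence
  \<open>b * norm \<mu> \<le> r\<close>; but \<open>norm (\<Phi> \<mu>)\<close> is at least
  \<open>r + \<delta>\<close>.\<close>

lemma bidual_apply_approx:
  assumes \<Phi>: "\<Phi> \<in> bidual s" and \<mu>: "\<mu> \<in> dual s" and "0 < \<delta>"
  obtains x where "norm x \<le> bidual_norm s \<Phi>"
    and "real_part (\<Phi> \<mu>) - \<delta> \<le> real_part (blinfun_apply \<mu> x)"
proof (rule ccontr)
  define b where "b = bidual_norm s \<Phi>"
  define r where "r = real_part (\<Phi> \<mu>) - \<delta>"
  assume "\<not> thesis"
  then have "\<not> (norm x \<le> b \<and> r \<le> real_part (blinfun_apply \<mu> x))" for x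
    using that[of x] by (auto simp: b_def r_def)
  then have lt: "real_part (blinfun_apply \<mu> x) < r" if "norm x \<le> b" for x
    using that by force
  have b: "0 \<le> b" using bidual_norm_nonneg[OF \<Phi>] by (simp add: b_def)
  have r: "0 < r" using lt[of 0] b real_part_of_real[of 0, where 'a='k] by (simp add: blinfun.zero_right)
  have norm_lt: "norm (blinfun_apply \<mu> x) < r" if x: "norm x \<le> b" for x
  proof (cases "blinfun_apply \<mu> x = 0")
    case False
    \<comment> \<open>A scalar of modulus 1 that rotates the value of \<mu> to its modulus.\<close>
    define c where "c = of_real (norm (blinfun_apply \<mu> x)) / blinfun_apply \<mu> x"
    have "norm (s c x) \<le> b" using x False by (simp add: norm_scale c_def norm_divide)
    from lt[OF this] show ?thesis using False by (simp add: dual_apply_scale[OF \<mu>] c_def)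
  qed (use r in simp)
  \<comment> \<open>Rescaling passes from the ball of radius \<open>b\<close> to all vectors; for
    radius 0 the bound is just \<open>0 < r\<close>.\<close>
  have bound: "b * norm \<mu> \<le> r"
  proof (cases "b = 0")
    case False
    have "norm \<mu> \<le> r / b"
    proof (rule norm_blinfun_bound)
      show "norm (blinfun_apply \<mu> x) \<le> r / b * norm x" for x
      proof (cases "x = 0")
        case False
        have "norm ((b / norm x) *\<^sub>R x) \<le> b" using False b by simp
        from norm_lt[OF this] show ?thesis
          using False b \<open>b \<noteq> 0\<close> by (simp add: blinfun.scaleR_right field_simps)
      qed (simp add: blinfun.zero_right)
    qed (use r b in simp)
    then show ?thesis using b False by (simp add: field_simps)
  qed (use r in simp)
  have "r + \<delta> \<le> b * norm \<mu>"
    using real_part_le_norm[of "\<Phi> \<mu>"] norm_apply_le_bidual_norm[OF \<Phi> \<mu>] by (simp add: r_def b_def)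
  with bound \<open>0 < \<delta>\<close> show False by simp
qed

text \<open>On the bidual this is a product of balls: the set is convex and its coordinates can be
  chosen independently. Linearity is left to the equations.\<close>

definition norm_dominated :: "(('k, 'e) functional2 \<Rightarrow> 'e) \<Rightarrow> bool" where
  "norm_dominated f \<longleftrightarrow> (\<forall>\<Phi>\<in>bidual s. norm (f \<Phi>) \<le> bidual_norm s \<Phi>)"

text \<open>\<open>g\<close> is a finite sum of functionals of separate coordinates, so
  \<open>bidual_apply_approx\<close> can be applied to each of them on its own.\<close>

lemma norm_dominated_approx:
  assumes "value_at_identity g v" and "0 < \<delta>"
  obtains f where "norm_dominated f" and "real_part v - \<delta> \<le> real_part (g f)"
proof -
  obtain J \<nu> where J: "finite J" "J \<subseteq> bidual s" "\<And>\<Phi>. \<Phi> \<in> J \<Longrightarrow> \<nu> \<Phi> \<in> dual s"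
    "\<And>f. g f = (\<Sum>\<Phi>\<in>J. blinfun_apply (\<nu> \<Phi>) (f \<Phi>))" "v = (\<Sum>\<Phi>\<in>J. \<Phi> (\<nu> \<Phi>))"
    using assms(1) by (auto simp: value_at_identity_def)
  \<comment> \<open>An equal share of the error for each coordinate; adding 1 covers an empty
    \<open>J\<close>.\<close>
  define \<eta> where "\<eta> = \<delta> / (real (card J) + 1)"
  have \<eta>: "0 < \<eta>" "card J * \<eta> \<le> \<delta>"
    using assms(2) by (auto simp: \<eta>_def field_simps)
  have "\<forall>\<Phi>\<in>J. \<exists>x. norm x \<le> bidual_norm s \<Phi> \<and>
      real_part (\<Phi> (\<nu> \<Phi>)) - \<eta> \<le> real_part (blinfun_apply (\<nu> \<Phi>) x)"
  proof
    fix \<Phi> assume "\<Phi> \<in> J"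
    then have "\<Phi> \<in> bidual s" "\<nu> \<Phi> \<in> dual s" using J by auto
    then show "\<exists>x. norm x \<le> bidual_norm s \<Phi> \<and>
        real_part (\<Phi> (\<nu> \<Phi>)) - \<eta> \<le> real_part (blinfun_apply (\<nu> \<Phi>) x)"
      using \<eta>(1) by (rule bidual_apply_approx) blast
  qed
  then obtain f where f: "\<And>\<Phi>. \<Phi> \<in> J \<Longrightarrow> norm (f \<Phi>) \<le> bidual_norm s \<Phi>"
    "\<And>\<Phi>. \<Phi> \<in> J \<Longrightarrow> real_part (\<Phi> (\<nu> \<Phi>)) - \<eta> \<le> real_part (blinfun_apply (\<nu> \<Phi>) (f \<Phi>))"
    by metis
  define f' where "f' \<Phi> = (if \<Phi> \<in> J then f \<Phi> else 0)" for \<Phi>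
  have "real_part v - \<delta> \<le> (\<Sum>\<Phi>\<in>J. real_part (\<Phi> (\<nu> \<Phi>)) - \<eta>)"
    using \<eta>(2) by (simp add: J(5) linear_sum[OF linear_real_part] sum_subtractf)
  also have "\<dots> \<le> (\<Sum>\<Phi>\<in>J. real_part (blinfun_apply (\<nu> \<Phi>) (f' \<Phi>)))"
    by (rule sum_mono) (simp add: f'_def f(2))
  also have "\<dots> = real_part (g f')"
    by (simp add: J(4) linear_sum[OF linear_real_part])
  finally have "real_part v - \<delta> \<le> real_part (g f')" .
  moreover have "norm_dominated f'"
    by (simp add: norm_dominated_def f'_def f(1) bidual_norm_nonneg)
  ultimately show thesis using that by blast
qed

text \<open>The identity family solves the linear equation \<open>L f = y\<close>, in the weak sense that makes
  \<open>L\<close> applicable to families in the bidual.\<close>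

definition solved_by_identity :: "((('k, 'e) functional2 \<Rightarrow> 'e) \<Rightarrow> 'e) \<Rightarrow> 'e \<Rightarrow> bool" where
  "solved_by_identity L y \<longleftrightarrow> linear L \<and>
     (\<forall>\<mu>\<in>dual s. value_at_identity (\<lambda>f. blinfun_apply \<mu> (L f)) (blinfun_apply \<mu> y))"

text \<open>If no norm dominated family solved all equations up to \<open>\<epsilon>\<close>, then real functionals
  \<open>F\<^sub>q\<close> would separate \<open>(L\<^sub>q f - y\<^sub>q)\<^sub>q\<close> from \<open>0\<close> uniformly in \<open>f\<close>. But \<open>\<Sum>\<^sub>q F\<^sub>q (L\<^sub>q f - y\<^sub>q)\<close>
  vanishes at the identity family, which can be approximated from the norm dominated ones.\<close>

theorem local_reflexivity:
  assumes R: "finite R" and sol: "\<And>L y. (L, y) \<in> R \<Longrightarrow> solved_by_identity L y" and "0 < \<epsilon>"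
  obtains f where "norm_dominated f" and "\<And>L y. (L, y) \<in> R \<Longrightarrow> norm (L f - y) < \<epsilon>"
proof (rule ccontr)
  assume "\<not> thesis"
  then have "\<not> norm_dominated f \<or> (\<exists>L y. (L, y) \<in> R \<and> \<not> norm (L f - y) < \<epsilon>)" for f
    using that by blast
  then have not_approx: "\<exists>L y. (L, y) \<in> R \<and> \<not> norm (L f - y) < \<epsilon>" if "norm_dominated f" for f
    using that by blast
  \<comment> \<open>The family of residuals of the equations.\<close>
  define w where "w f = (\<lambda>q. if q \<in> R then fst q f - snd q else 0)"
    for f and q :: "((('k, 'e) functional2 \<Rightarrow> 'e) \<Rightarrow> 'e) \<times> 'e"
  define S where "S = w ` {f. norm_dominated f}"
  have far: "\<epsilon> \<le> (\<Sum>q\<in>R. norm (w f q))" if f: "norm_dominated f" for f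
  proof -
    have "\<exists>q\<in>R. \<epsilon> \<le> norm (w f q)"
      using not_approx[OF f] by (force simp: w_def not_less)
    then obtain q where q: "q \<in> R" "\<epsilon> \<le> norm (w f q)" by blast
    have "norm (w f q) \<le> (\<Sum>q\<in>R. norm (w f q))"
      by (rule member_le_sum) (use R q in auto)
    with q(2) show ?thesis by simp
  qed
  have "convex S"
  proof (rule convexI)
    fix a b and t u :: real
    assume "a \<in> S" "b \<in> S" and tu: "0 \<le> t" "0 \<le> u" "t + u = 1"
    then obtain f g where f: "norm_dominated f" "a = w f" and g: "norm_dominated g" "b = w g"
      by (auto simp: S_def)
    have "norm_dominated (t *\<^sub>R f + u *\<^sub>R g)"
      unfolding norm_dominated_def
    proof
      fix \<Phi> assume \<Phi>: "\<Phi> \<in> bidual s"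
      have "norm (t *\<^sub>R f \<Phi> + u *\<^sub>R g \<Phi>) \<le> t * bidual_norm s \<Phi> + u * bidual_norm s \<Phi>"
        using f(1) g(1) \<Phi> tu
        by (intro norm_triangle_le add_mono) (auto simp: norm_dominated_def mult_left_mono)
      also have "\<dots> = bidual_norm s \<Phi>"
        using tu(3) by (simp flip: distrib_right)
      finally show "norm ((t *\<^sub>R f + u *\<^sub>R g) \<Phi>) \<le> bidual_norm s \<Phi>" by simp
    qed
    moreover have "t *\<^sub>R a + u *\<^sub>R b = w (t *\<^sub>R f + u *\<^sub>R g)"
    proof
      fix q show "(t *\<^sub>R a + u *\<^sub>R b) q = w (t *\<^sub>R f + u *\<^sub>R g) q"
      proof (cases "q \<in> R")
        case True
        have "linear (fst q)" using sol[of "fst q" "snd q"] True by (simp add: solved_by_identity_def)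
        then have "fst q (t *\<^sub>R f + u *\<^sub>R g) = t *\<^sub>R fst q f + u *\<^sub>R fst q g"
          by (simp add: linear_add linear_scale)
        \<comment> \<open>Right-hand sides survive convex combinations because
          \<open>t + u = 1\<close>.\<close>
        moreover have "t *\<^sub>R (x - z) + u *\<^sub>R (y - z) = t *\<^sub>R x + u *\<^sub>R y - (t + u) *\<^sub>R z"
          for x y z :: 'e
          by (simp add: algebra_simps)
        ultimately show ?thesis
          using True by (simp add: f(2) g(2) w_def tu(3))
      qed (simp add: f(2) g(2) w_def)
    qed
    ultimately show "t *\<^sub>R a + u *\<^sub>R b \<in> S"
      unfolding S_def by blast
  qed
  moreover have "S \<noteq> {}"
    using bidual_norm_nonneg by (auto simp: S_def norm_dominated_def intro: exI[of _ "\<lambda>_. 0"])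
  moreover have "\<And>v. v \<in> S \<Longrightarrow> \<epsilon> \<le> (\<Sum>q\<in>R. norm (v q))"
    using far by (auto simp: S_def)
  ultimately obtain F :: "((('k, 'e) functional2 \<Rightarrow> 'e) \<Rightarrow> 'e) \<times> 'e \<Rightarrow> 'e \<Rightarrow> real"
    where F: "\<And>q. q \<in> R \<Longrightarrow> bounded_linear (F q)"
    and F_S: "\<And>v. v \<in> S \<Longrightarrow> \<epsilon> \<le> (\<Sum>q\<in>R. F q (v q))"
    by (rule finite_family_separation[OF _ _ R]) (assumption, rule that, blast+)
  have sep: "\<epsilon> \<le> (\<Sum>q\<in>R. F q (w f q))" if "norm_dominated f" for f
    using that by (intro F_S) (simp add: S_def)
  have "\<forall>q\<in>R. \<exists>\<mu>. \<mu> \<in> dual s \<and> (\<forall>x. real_part (blinfun_apply \<mu> x) = F q x)"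
    using real_functional_lift[OF F] by metis
  then obtain \<mu> where \<mu>: "\<And>q. q \<in> R \<Longrightarrow> \<mu> q \<in> dual s"
    "\<And>q x. q \<in> R \<Longrightarrow> real_part (blinfun_apply (\<mu> q) x) = F q x"
    by metis
  \<comment> \<open>The sign makes the approximation an upper bound: some dominated \<open>f\<close>
    has separated sum at most \<open>\<epsilon> / 2\<close>, against the lower bound
    \<epsilon>.\<close>
  have "value_at_identity (\<lambda>f. \<Sum>q\<in>R. - blinfun_apply (\<mu> q) (fst q f))
      (\<Sum>q\<in>R. - blinfun_apply (\<mu> q) (snd q))"
    using sol \<mu>(1) unfolding solved_by_identity_def
    by (intro value_at_identity_sum[OF R] value_at_identity_minus) auto
  then obtain f where f: "norm_dominated f"
    and le: "real_part (\<Sum>q\<in>R. - blinfun_apply (\<mu> q) (snd q)) - \<epsilon> / 2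
      \<le> real_part (\<Sum>q\<in>R. - blinfun_apply (\<mu> q) (fst q f))"
    by (rule norm_dominated_approx[of _ _ "\<epsilon> / 2"]) (use \<open>0 < \<epsilon>\<close> in auto)
  have "(\<Sum>q\<in>R. F q (w f q)) = (\<Sum>q\<in>R. F q (fst q f)) - (\<Sum>q\<in>R. F q (snd q))"
    unfolding w_def sum_subtractf[symmetric]
    by (rule sum.cong) (auto simp: linear_diff[OF bounded_linear.linear[OF F]])
  also have "\<dots> \<le> \<epsilon> / 2"
    using le \<mu>(2) by (simp add: linear_sum[OF linear_real_part] linear_neg[OF linear_real_part] sum_negf)
  finally show False using sep[OF f] \<open>0 < \<epsilon>\<close> by simp
qed

section \<open>The equations imposed on the families\<close>

lemma solved_by_identity_add:
  assumes "\<Phi> \<in> bidual s" "\<Psi> \<in> bidual s"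
  shows "solved_by_identity (\<lambda>f. f (bidual_add \<Phi> \<Psi>) - f \<Phi> - f \<Psi>) 0"
  unfolding solved_by_identity_def
proof (intro conjI ballI)
  fix \<mu> assume \<mu>: "\<mu> \<in> dual s"
  have "value_at_identity (\<lambda>f. \<mu> (f (bidual_add \<Phi> \<Psi>)) - \<mu> (f \<Phi>) - \<mu> (f \<Psi>))
      (bidual_add \<Phi> \<Psi> \<mu> - \<Phi> \<mu> - \<Psi> \<mu>)"
    by (intro value_at_identity_diff value_at_identity_eval bidual_add_in_bidual assms \<mu>)
  then show "value_at_identity (\<lambda>f. \<mu> (f (bidual_add \<Phi> \<Psi>) - f \<Phi> - f \<Psi>)) (\<mu> 0)"
    by (simp add: bidual_add_def blinfun.diff_right)
qed (rule linearI; simp add: algebra_simps)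

text \<open>Moving the scalar from the vector to \<mu> leaves an expression in evaluations of
  \<open>f\<close> only.\<close>

lemma solved_by_identity_scale:
  assumes "\<Phi> \<in> bidual s"
  shows "solved_by_identity (\<lambda>f. f (bidual_scale c \<Phi>) - s c (f \<Phi>)) 0"
  unfolding solved_by_identity_def
proof (intro conjI ballI)
  fix \<mu> assume \<mu>: "\<mu> \<in> dual s"
  have "value_at_identity (\<lambda>f. \<mu> (f (bidual_scale c \<Phi>)) - dual_scale c \<mu> (f \<Phi>))
      (bidual_scale c \<Phi> \<mu> - \<Phi> (dual_scale c \<mu>))"
    by (intro value_at_identity_diff value_at_identity_eval bidual_scale_in_bidual
        dual_scale_in_dual assms \<mu>)
  then show "value_at_identity (\<lambda>f. \<mu> (f (bidual_scale c \<Phi>) - s c (f \<Phi>))) (\<mu> 0)"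
    using \<mu> by (simp add: bidual_scale_def bidual_apply_scale[OF assms] blinfun.diff_right
        dual_scale_apply dual_apply_scale)
qed (rule linearI; simp add: algebra_simps linear_add linear_scale
    bounded_linear.linear[OF bounded_linear_scale])

lemma solved_by_identity_canonical: "solved_by_identity (\<lambda>f. f (canonical_embedding s x)) x"
  unfolding solved_by_identity_def
proof (intro conjI ballI)
  fix \<mu> assume \<mu>: "\<mu> \<in> dual s"
  show "value_at_identity (\<lambda>f. \<mu> (f (canonical_embedding s x))) (\<mu> x)"
    using value_at_identity_eval[OF canonical_embedding_in_bidual \<mu>, of x] \<mu>
    by (simp add: canonical_embedding_def)
qed (rule linearI; simp)

text \<open>Transposition moves \<open>T a\<close> to \<mu>, which is exactly how the action on the
  bidual is defined.\<close>

lemma solved_by_identity_lact: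
  assumes T: "operator_family T" and \<Phi>: "\<Phi> \<in> bidual s"
  shows "solved_by_identity (\<lambda>f. f (bidual_lact s T a \<Phi>) - T a (f \<Phi>)) 0"
  unfolding solved_by_identity_def
proof (intro conjI ballI)
  fix \<mu> assume \<mu>: "\<mu> \<in> dual s"
  have "value_at_identity (\<lambda>f. \<mu> (f (bidual_lact s T a \<Phi>)) - dual_ract T \<mu> a (f \<Phi>))
      (bidual_lact s T a \<Phi> \<mu> - \<Phi> (dual_ract T \<mu> a))"
    by (intro value_at_identity_diff value_at_identity_eval bidual_lact_in_bidual
        dual_ract_in_dual T \<Phi> \<mu>)
  then show "value_at_identity (\<lambda>f. \<mu> (f (bidual_lact s T a \<Phi>) - T a (f \<Phi>))) (\<mu> 0)"
    using \<mu> by (simp add: bidual_lact_def dual_ract_apply[OF T] blinfun.diff_right)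
next
  have "linear (T a)" using T by (simp add: operator_family_def bounded_linear.linear)
  then show "linear (\<lambda>f. f (bidual_lact s T a \<Phi>) - T a (f \<Phi>))"
    by (intro linearI) (simp_all add: linear_add linear_scale algebra_simps)
qed

text \<open>The scalar equation \<open>\<mu> (f \<Phi>) = \<Phi> \<mu>\<close>, multiplied by a vector in order to be
  an equation in the space.\<close>

lemma solved_by_identity_apply:
  assumes \<Phi>: "\<Phi> \<in> bidual s" and \<mu>: "\<mu> \<in> dual s"
  shows "solved_by_identity (\<lambda>f. s (\<mu> (f \<Phi>)) e) (s (\<Phi> \<mu>) e)"
  unfolding solved_by_identity_def
proof (intro conjI ballI)
  fix \<nu> assume \<nu>: "\<nu> \<in> dual s"
  have "value_at_identity (\<lambda>f. dual_scale (\<nu> e) \<mu> (f \<Phi>)) (\<Phi> (dual_scale (\<nu> e) \<mu>))"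
    by (intro value_at_identity_eval dual_scale_in_dual \<Phi> \<mu>)
  then show "value_at_identity (\<lambda>f. \<nu> (s (\<mu> (f \<Phi>)) e)) (\<nu> (s (\<Phi> \<mu>) e))"
    using \<Phi> \<mu> \<nu> by (simp add: bidual_apply_scale dual_scale_apply dual_apply_scale mult.commute)
next
  show "linear (\<lambda>f. s (\<mu> (f \<Phi>)) e)"
  proof (rule linearI)
    show "s (\<mu> ((r *\<^sub>R f) \<Phi>)) e = r *\<^sub>R s (\<mu> (f \<Phi>)) e" for r f
      using scale_of_real[of r "s (\<mu> (f \<Phi>)) e"]
      by (simp add: blinfun.scaleR_right scaleR_conv_of_real)
  qed (simp add: blinfun.add_right scale_left_distrib)
qed

section \<open>Approximate solutions along the index set\<close>

text \<open>At the index \<open>(P, M, B, n)\<close> the following equations are to be solved up to \<open>1 / (n + 1)\<close>.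
  Scalars do not occur in the index. A scalar \<open>c\<close> is recovered from \<open>\<Phi>\<close>, \<open>c \<Phi>\<close> and any \<open>\<mu>\<close> with
  \<open>\<Phi> \<mu> \<noteq> 0\<close>, and a vector from its canonical image.\<close>

definition index_equations ::
    "('c \<Rightarrow> 'e \<Rightarrow> 'e) set \<Rightarrow> 'e \<Rightarrow> ('k, 'e, 'c) ultra_index \<Rightarrow>
      (((('k, 'e) functional2 \<Rightarrow> 'e) \<Rightarrow> 'e) \<times> 'e) set" where
  "index_equations Ts e = (\<lambda>(P, M, B, n).
     (\<lambda>(\<Phi>, \<Psi>). (\<lambda>f. f (bidual_add \<Phi> \<Psi>) - f \<Phi> - f \<Psi>, 0)) ` ((P \<inter> bidual s) \<times> (P \<inter> bidual s)) \<union>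
     (\<lambda>(\<Phi>, \<Psi>, \<mu>). (\<lambda>f. f (bidual_scale (\<Psi> \<mu> / \<Phi> \<mu>) \<Phi>) - s (\<Psi> \<mu> / \<Phi> \<mu>) (f \<Phi>), 0)) `
       ((P \<inter> bidual s) \<times> P \<times> M) \<union>
     (\<lambda>x. (\<lambda>f. f (canonical_embedding s x), x)) ` (canonical_embedding s -` P) \<union>
     (\<lambda>(T, a, \<Phi>). (\<lambda>f. f (bidual_lact s T a \<Phi>) - T a (f \<Phi>), 0)) ` (Ts \<times> B \<times> (P \<inter> bidual s)) \<union>
     (\<lambda>(\<Phi>, \<mu>). (\<lambda>f. s (blinfun_apply \<mu> (f \<Phi>)) e, s (\<Phi> \<mu>) e)) ` ((P \<inter> bidual s) \<times> (M \<inter> dual s)))"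

text \<open>The index type also contains infinite sets; this filter is concentrated on indices whose
  three sets are finite and contain any given finite sets.\<close>

definition index_filter :: "('k, 'e, 'c) ultra_index filter" where
  "index_filter = finite_subsets_at_top UNIV \<times>\<^sub>F finite_subsets_at_top UNIV \<times>\<^sub>F
     finite_subsets_at_top UNIV \<times>\<^sub>F sequentially"

lemma index_filter_neq_bot: "index_filter \<noteq> bot"
  by (simp add: index_filter_def prod_filter_eq_bot)

lemma eventually_index_filter:
  assumes "finite P\<^sub>0" "finite M\<^sub>0" "finite B\<^sub>0"
  shows "eventually (\<lambda>(P, M, B, n). (finite P \<and> P\<^sub>0 \<subseteq> P) \<and> (finite M \<and> M\<^sub>0 \<subseteq> M) \<and>
    (finite B \<and> B\<^sub>0 \<subseteq> B) \<and> N \<le> n) (index_filter :: ('k, 'e, 'c) ultra_index filter)"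
proof -
  have fin: "eventually (\<lambda>Y. finite Y \<and> X \<subseteq> Y) (finite_subsets_at_top UNIV)"
    if "finite X" for X :: "'x set"
    unfolding eventually_finite_subsets_at_top using that by blast
  show ?thesis
    unfolding index_filter_def case_prod_beta
    by (intro eventually_prodI[of "\<lambda>P. finite P \<and> P\<^sub>0 \<subseteq> P" _
          "\<lambda>x. (finite (fst x) \<and> M\<^sub>0 \<subseteq> fst x) \<and> (finite (fst (snd x)) \<and> B\<^sub>0 \<subseteq> fst (snd x)) \<and>
            N \<le> snd (snd x)"]
        eventually_prodI[of "\<lambda>M. finite M \<and> M\<^sub>0 \<subseteq> M" _
          "\<lambda>x. (finite (fst x) \<and> B\<^sub>0 \<subseteq> fst x) \<and> N \<le> snd x"]
        eventually_prodI[of "\<lambda>B. finite B \<and> B\<^sub>0 \<subseteq> B" _ "\<lambda>n. N \<le> n"] fin assms eventually_ge_at_top)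
qed

text \<open>For the canonical equations this rests on injectivity of the canonical embedding: only
  finitely many vectors have their image in \<open>P\<close>.\<close>

lemma finite_index_equations:
  assumes "finite Ts" "finite P" "finite M" "finite B"
  shows "finite (index_equations Ts e (P, M, B, n))"
  unfolding index_equations_def prod.case using assms
  by (intro finite_UnI finite_imageI finite_cartesian_product finite_Int)
    (auto intro: finite_vimageI inj_canonical_embedding)

lemma index_equations_solved:
  assumes "\<And>T. T \<in> Ts \<Longrightarrow> operator_family T" and "(L, y) \<in> index_equations Ts e i"
  shows "solved_by_identity L y"
  using assms unfolding index_equations_def
  by (auto simp: solved_by_identity_add solved_by_identity_scale solved_by_identity_canonical
      solved_by_identity_lact solved_by_identity_apply)

text \<open>Where there are finitely many equations, \<open>local_reflexivity\<close> solves them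
  with error below \<open>1 / (n + 1)\<close>. Elsewhere the zero family is a dominated default,
  which limits along the filter do not see.\<close>

lemma index_solution:
  fixes Ts :: "('c \<Rightarrow> 'e \<Rightarrow> 'e) set"
  assumes "finite Ts" and "\<And>T. T \<in> Ts \<Longrightarrow> operator_family T"
  obtains x :: "('k, 'e, 'c) ultra_index \<Rightarrow> ('k, 'e) functional2 \<Rightarrow> 'e"
  where "\<And>i. norm_dominated (x i)"
    and "\<And>L y. eventually (\<lambda>i. (L, y) \<in> index_equations Ts e i) index_filter \<Longrightarrow>
      ((\<lambda>i. L (x i)) \<longlongrightarrow> y) index_filter"
proof -
  define close where "close i f \<longleftrightarrow> (\<forall>(L, y)\<in>index_equations Ts e i.
      norm (L f - y) < 1 / (real (snd (snd (snd i))) + 1))"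
    for i :: "('k, 'e, 'c) ultra_index" and f
  have "\<exists>f. norm_dominated f \<and> (finite (index_equations Ts e i) \<longrightarrow> close i f)" for i
  proof (cases "finite (index_equations Ts e i)")
    case True
    have sol: "solved_by_identity L y" if "(L, y) \<in> index_equations Ts e i" for L y
      by (rule index_equations_solved[of Ts, OF assms(2) that])
    have pos: "(0::real) < 1 / (real (snd (snd (snd i))) + 1)" by simp
    obtain f where "norm_dominated f"
      "\<And>L y. (L, y) \<in> index_equations Ts e i \<Longrightarrow> norm (L f - y) < 1 / (real (snd (snd (snd i))) + 1)"
      by (rule local_reflexivity[OF True sol pos]) (assumption, rule that, blast+)
    then show ?thesis by (auto simp: close_def)
  next
    case False
    then show ?thesis
      using bidual_norm_nonneg by (intro exI[of _ "\<lambda>_. 0"]) (simp add: norm_dominated_def)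
  qed
  then obtain x where dom: "\<And>i. norm_dominated (x i)"
    and close: "\<And>i. finite (index_equations Ts e i) \<Longrightarrow> close i (x i)"
    by metis
  have "((\<lambda>i. L (x i)) \<longlongrightarrow> y) index_filter"
    if eq: "eventually (\<lambda>i. (L, y) \<in> index_equations Ts e i) index_filter" for L y
  proof (rule tendstoI)
    fix \<epsilon> :: real assume "0 < \<epsilon>"
    then obtain N where N: "1 / (real N + 1) < \<epsilon>"
      using nat_approx_posE by (metis add.commute of_nat_Suc)
    have "eventually (\<lambda>(P, M, B, n). (finite P \<and> {} \<subseteq> P) \<and> (finite M \<and> {} \<subseteq> M) \<and>
        (finite B \<and> {} \<subseteq> B) \<and> N \<le> n) (index_filter :: ('k, 'e, 'c) ultra_index filter)"
      by (rule eventually_index_filter) auto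
    with eq show "eventually (\<lambda>i. dist (L (x i)) y < \<epsilon>) index_filter"
    proof eventually_elim
      case (elim i)
      obtain P M B n where i: "i = (P, M, B, n)" by (cases i)
      have "close i (x i)"
        using elim(2) by (intro close) (simp add: i finite_index_equations assms(1))
      then have "norm (L (x i) - y) < 1 / (real n + 1)"
        using elim(1) by (force simp: close_def i)
      also have "\<dots> \<le> 1 / (real N + 1)"
        using elim(2) by (intro divide_left_mono) (auto simp: i)
      finally show ?case using N by (simp add: dist_norm)
    qed
  qed
  with dom show thesis by (rule that)
qed

end

section \<open>Ultrapowers\<close>

lemma mem_ultrapower_class:
  "y \<in> ultrapower_class U x \<longleftrightarrow>
    x \<in> bounded_families \<and> y \<in> bounded_families \<and> ((\<lambda>i. x i - y i) \<longlongrightarrow> 0) U"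
  for x y :: "'i \<Rightarrow> 'e::banach"
proof -
  have "(\<lambda>i. x i - y i) \<in> bounded_families" if "x \<in> bounded_families" "y \<in> bounded_families"
    using bounded_minus_comp[of x UNIV y] that by (simp add: bounded_families_def)
  then show ?thesis
    by (auto simp: ultrapower_class_def ultrapower_rel_def null_families_def tendsto_norm_zero_iff)
qed

lemma ultrapower_class_self: "x \<in> bounded_families \<Longrightarrow> x \<in> ultrapower_class U x"
  by (simp add: mem_ultrapower_class)

lemma ultrapower_class_eqI:
  assumes "x \<in> bounded_families" "y \<in> bounded_families" "((\<lambda>i. x i - y i) \<longlongrightarrow> 0) U"
  shows "ultrapower_class U x = ultrapower_class U y"
  unfolding ultrapower_class_def
  by (rule equiv_class_eq[OF equiv_ultrapower_rel])
    (use assms in \<open>simp add: mem_ultrapower_class[unfolded ultrapower_class_def Image_singleton_iff]\<close>)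

lemma ultrapower_class_in_ultrapower:
  "x \<in> bounded_families \<Longrightarrow> ultrapower_class U x \<in> ultrapower U"
  unfolding ultrapower_def ultrapower_class_def by (rule quotientI)

lemma bounded_families_add:
  "x \<in> bounded_families \<Longrightarrow> y \<in> bounded_families \<Longrightarrow> (\<lambda>i. x i + y i) \<in> bounded_families"
  using bounded_plus_comp[of x UNIV y] by (simp add: bounded_families_def)

lemma bounded_families_linear:
  "bounded_linear T \<Longrightarrow> x \<in> bounded_families \<Longrightarrow> (\<lambda>i. T (x i)) \<in> bounded_families"
  using bounded_linear_image[of "range x" T] by (simp add: bounded_families_def image_image)

lemma ultrapower_add_class:
  assumes "x \<in> bounded_families" "y \<in> bounded_families"
  shows "ultrapower_add U (ultrapower_class U x) (ultrapower_class U y)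
    = ultrapower_class U (\<lambda>i. x i + y i)"
proof -
  have "ultrapower_class U (\<lambda>i. x' i + y' i) = ultrapower_class U (\<lambda>i. x i + y i)"
    if x': "x' \<in> ultrapower_class U x" and y': "y' \<in> ultrapower_class U y" for x' y'
  proof (rule ultrapower_class_eqI[symmetric])
    have "((\<lambda>i. (x i - x' i) + (y i - y' i)) \<longlongrightarrow> 0 + 0) U"
      using x' y' by (intro tendsto_add) (simp_all add: mem_ultrapower_class)
    then show "((\<lambda>i. x i + y i - (x' i + y' i)) \<longlongrightarrow> 0) U" by (simp add: algebra_simps)
  qed (use x' y' in \<open>simp_all add: mem_ultrapower_class bounded_families_add\<close>)
  then show ?thesis
    unfolding ultrapower_add_def
    by (intro UN_constant_eq[OF ultrapower_class_self] assms ballI)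
qed

text \<open>Covers both scalar multiplication and the module actions.\<close>

lemma ultrapower_class_linear:
  assumes T: "bounded_linear T" and x: "x \<in> bounded_families"
  shows "(\<Union>x'\<in>ultrapower_class U x. ultrapower_class U (\<lambda>i. T (x' i)))
    = ultrapower_class U (\<lambda>i. T (x i))"
proof -
  have "ultrapower_class U (\<lambda>i. T (x' i)) = ultrapower_class U (\<lambda>i. T (x i))"
    if x': "x' \<in> ultrapower_class U x" for x'
  proof (rule ultrapower_class_eqI[symmetric])
    have "((\<lambda>i. T (x i - x' i)) \<longlongrightarrow> 0) U"
      using x' by (intro bounded_linear.tendsto_zero[OF T]) (simp add: mem_ultrapower_class)
    then show "((\<lambda>i. T (x i) - T (x' i)) \<longlongrightarrow> 0) U"
      by (simp add: linear_diff[OF bounded_linear.linear[OF T]])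
  qed (use x' in \<open>simp_all add: mem_ultrapower_class bounded_families_linear[OF T]\<close>)
  then show ?thesis by (intro UN_constant_eq[OF ultrapower_class_self] x ballI)
qed

text \<open>\<open>the_elem\<close> evaluates singletons, so a value on a class needs both a
  representative and independence of its choice.\<close>

lemma the_elem_image_const:
  assumes "a \<in> A" and "\<And>x. x \<in> A \<Longrightarrow> h x = v"
  shows "the_elem (h ` A) = v"
proof -
  have "h ` A = {v}" using assms by auto
  then show ?thesis by simp
qed

text \<open>By the reverse triangle inequality the norms of two representatives differ by a null
  family.\<close>

lemma ultrapower_norm_class:
  assumes "U \<noteq> bot" and x: "x \<in> bounded_families" and lim: "((\<lambda>i. norm (x i)) \<longlongrightarrow> r) U"
  shows "ultrapower_norm U (ultrapower_class U x) = r"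
  unfolding ultrapower_norm_def
proof (rule the_elem_image_const[OF ultrapower_class_self[OF x]])
  fix x' assume "x' \<in> ultrapower_class U x"
  then have "((\<lambda>i. norm (x i - x' i)) \<longlongrightarrow> 0) U"
    by (simp add: mem_ultrapower_class tendsto_norm_zero)
  then have "((\<lambda>i. norm (x' i) - norm (x i)) \<longlongrightarrow> 0) U"
    by (rule Lim_null_comparison[rotated])
      (simp add: norm_triangle_ineq3[of "x' _" "x _"] norm_minus_commute[of "x _" "x' _"])
  from tendsto_add[OF this lim] have "((\<lambda>i. norm (x' i)) \<longlongrightarrow> r) U" by simp
  with assms(1) show "Lim U (\<lambda>i. norm (x' i)) = r" by (rule tendsto_Lim)
qed

lemma ultrapower_sigma_class:
  assumes "U \<noteq> bot" and x: "x \<in> bounded_families" and \<mu>: "\<mu> \<in> dual s"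
    and lim: "((\<lambda>i. blinfun_apply \<mu> (x i)) \<longlongrightarrow> v) U"
  shows "ultrapower_sigma s U (ultrapower_class U x) \<mu> = v"
proof -
  have "the_elem ((\<lambda>x. Lim U (\<lambda>i. blinfun_apply \<mu> (x i))) ` ultrapower_class U x) = v"
  proof (rule the_elem_image_const[OF ultrapower_class_self[OF x]])
    fix x' assume "x' \<in> ultrapower_class U x"
    then have "((\<lambda>i. blinfun_apply \<mu> (x i - x' i)) \<longlongrightarrow> 0) U"
      by (intro bounded_linear.tendsto_zero[OF blinfun.bounded_linear_right])
        (simp add: mem_ultrapower_class)
    from tendsto_diff[OF lim this] have "((\<lambda>i. blinfun_apply \<mu> (x' i)) \<longlongrightarrow> v) U"
      by (simp add: blinfun.diff_right)
    with assms(1) show "Lim U (\<lambda>i. blinfun_apply \<mu> (x' i)) = v" by (rule tendsto_Lim)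
  qed
  with \<mu> show ?thesis by (simp add: ultrapower_sigma_def)
qed

section \<open>The module map into the ultrapower\<close>

context banach_space_over
begin

text \<open>A finite set \<open>Ts\<close> allows one \<open>K\<close> to respect several actions at
  once, as bimodules require.\<close>

theorem bidual_into_ultrapower:
  fixes Ts :: "('c \<Rightarrow> 'e \<Rightarrow> 'e) set"
  assumes Ts: "finite Ts" and ops: "\<And>T. T \<in> Ts \<Longrightarrow> operator_family T"
  shows "\<exists>(U :: ('k, 'e, 'c) ultra_index filter) K.
    ultrafilter U \<and> nonprincipal U \<and> countably_incomplete U \<and>
    linear_isometry_into_ultrapower s U K \<and>
    (\<forall>T\<in>Ts. left_module_hom_into_ultrapower s T U K) \<and>
    (\<forall>\<Phi>\<in>bidual s. ultrapower_sigma s U (K \<Phi>) = \<Phi>) \<and>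
    (\<forall>x. K (canonical_embedding s x) = ultrapower_canonical U x)"
proof -
  obtain U :: "('k, 'e, 'c) ultra_index filter" where U: "U \<le> index_filter" "ultrafilter U"
    using ex_ultrafilter_le[OF index_filter_neq_bot] by blast
  then have U_bot: "U \<noteq> bot" by (simp add: ultrafilter_def)
  have ev: "eventually (\<lambda>(P, M, B, n). P\<^sub>0 \<subseteq> P \<and> M\<^sub>0 \<subseteq> M \<and> B\<^sub>0 \<subseteq> B \<and> N \<le> n) index_filter"
    if "finite P\<^sub>0" "finite M\<^sub>0" "finite B\<^sub>0"
    for P\<^sub>0 :: "('k, 'e) functional2 set" and M\<^sub>0 :: "('e \<Rightarrow>\<^sub>L 'k) set" and B\<^sub>0 :: "'c set" and N
    using eventually_index_filter[OF that, of N] by (rule eventually_mono) auto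
  have large: "eventually (\<lambda>i. N \<le> snd (snd (snd i))) U" for N
    by (rule eventually_mono[OF filter_leD[OF U(1) ev[of "{}" "{}" "{}" N]]]) auto

  have "nonprincipal U"
    unfolding nonprincipal_def
  proof (intro allI notI)
    fix j assume "eventually (\<lambda>i. i = j) U"
    \<comment> \<open>The numerical component tends to infinity along \<open>U\<close>, so it
      eventually exceeds that of \<open>j\<close>.\<close>
    with large[of "Suc (snd (snd (snd j)))"] have "eventually (\<lambda>i. False) U"
      by eventually_elim auto
    with U_bot show False by (simp add: trivial_limit_def)
  qed
  moreover have "countably_incomplete U"
  proof -
    let ?A = "\<lambda>N. {i :: ('k, 'e, 'c) ultra_index. N \<le> snd (snd (snd i))}"
    have "\<Inter>(range ?A) = {}"
    proof -
      have "i \<notin> ?A (Suc (snd (snd (snd i))))" for i by simp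
      then show ?thesis by blast
    qed
    then have "\<not> eventually (\<lambda>i. i \<in> \<Inter>(range ?A)) U"
      using U_bot by (simp only:) (simp add: trivial_limit_def)
    moreover have "\<forall>A\<in>range ?A. eventually (\<lambda>i. i \<in> A) U" using large by simp
    ultimately show ?thesis
      unfolding countably_incomplete_def by (intro exI[of _ "range ?A"] conjI) simp_all
  qed
  \<comment> \<open>A nonzero vector that carries the scalar equations; it is 0 only if the whole
    space is.\<close>
  moreover define e :: 'e where "e = (SOME e. e \<noteq> 0 \<or> (\<forall>x::'e. x = 0))"
  have e: "e \<noteq> 0 \<or> (\<forall>x::'e. x = 0)"
    unfolding e_def by (rule someI_ex) blast
  obtain x :: "('k, 'e, 'c) ultra_index \<Rightarrow> ('k, 'e) functional2 \<Rightarrow> 'e"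
    where dom: "\<And>i. norm_dominated (x i)"
      and "\<And>L y. eventually (\<lambda>i. (L, y) \<in> index_equations Ts e i) index_filter \<Longrightarrow>
        ((\<lambda>i. L (x i)) \<longlongrightarrow> y) index_filter"
    by (rule index_solution[OF Ts ops]) (assumption, rule that, blast+)
  then have lim: "((\<lambda>i. L (x i)) \<longlongrightarrow> y) U"
    if "eventually (\<lambda>i. (L, y) \<in> index_equations Ts e i) index_filter" for L y
    using that tendsto_mono[OF U(1)] by blast
  have lim_at: "((\<lambda>i. L (x i)) \<longlongrightarrow> y) U"
    if "finite P\<^sub>0" "finite M\<^sub>0" "finite B\<^sub>0"
      and "\<And>P M B n. P\<^sub>0 \<subseteq> P \<Longrightarrow> M\<^sub>0 \<subseteq> M \<Longrightarrow> B\<^sub>0 \<subseteq> B \<Longrightarrow> (L, y) \<in> index_equations Ts e (P, M, B, n)"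
    for P\<^sub>0 M\<^sub>0 B\<^sub>0 L y
    by (rule lim, rule eventually_mono[OF ev[OF that(1-3), of 0]]) (use that(4) in auto)
  have bdd: "(\<lambda>i. x i \<Phi>) \<in> bounded_families" if "\<Phi> \<in> bidual s" for \<Phi>
    using dom that
    by (auto simp: bounded_families_def norm_dominated_def intro!: boundedI[of _ "bidual_norm s \<Phi>"])

  \<comment> \<open>Relations in the limit along the ultrafilter\<close>
  have lim_add: "((\<lambda>i. x i (bidual_add \<Phi> \<Psi>) - x i \<Phi> - x i \<Psi>) \<longlongrightarrow> 0) U"
    if "\<Phi> \<in> bidual s" "\<Psi> \<in> bidual s" for \<Phi> \<Psi>
  proof (rule lim_at[of "{\<Phi>, \<Psi>}" "{}" "{}"])
    fix P :: "('k, 'e) functional2 set" and M :: "('e \<Rightarrow>\<^sub>L 'k) set" and B :: "'c set" and n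
    assume "{\<Phi>, \<Psi>} \<subseteq> P" "{} \<subseteq> M" "{} \<subseteq> B"
    then have "(\<Phi>, \<Psi>) \<in> (P \<inter> bidual s) \<times> (P \<inter> bidual s)" using that by simp
    then show "(\<lambda>f. f (bidual_add \<Phi> \<Psi>) - f \<Phi> - f \<Psi>, 0) \<in> index_equations Ts e (P, M, B, n)"
      unfolding index_equations_def prod.case
      by (rule UnI1[OF UnI1[OF UnI1[OF UnI1[OF image_eqI[rotated]]]]]) simp
  qed auto
  have lim_scale: "((\<lambda>i. x i (bidual_scale c \<Phi>) - s c (x i \<Phi>)) \<longlongrightarrow> 0) U"
    if \<Phi>: "\<Phi> \<in> bidual s" for c \<Phi>
  \<comment> \<open>No quotient recovers \<open>c\<close> if \<Phi> vanishes, but then domination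
    forces \<open>x i \<Phi> = 0\<close>.\<close>
  proof (cases "\<exists>\<mu>. \<Phi> \<mu> \<noteq> 0")
    case True
    then obtain \<mu> where "\<Phi> \<mu> \<noteq> 0" by blast
    then have c: "bidual_scale c \<Phi> \<mu> / \<Phi> \<mu> = c" by (simp add: bidual_scale_def)
    show ?thesis
    proof (rule lim_at[of "{\<Phi>, bidual_scale c \<Phi>}" "{\<mu>}" "{}"])
      fix P :: "('k, 'e) functional2 set" and M :: "('e \<Rightarrow>\<^sub>L 'k) set" and B :: "'c set" and n
      assume "{\<Phi>, bidual_scale c \<Phi>} \<subseteq> P" "{\<mu>} \<subseteq> M" "{} \<subseteq> B"
      then have "(\<Phi>, bidual_scale c \<Phi>, \<mu>) \<in> (P \<inter> bidual s) \<times> P \<times> M" using \<Phi> by simp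
      then show "(\<lambda>f. f (bidual_scale c \<Phi>) - s c (f \<Phi>), 0) \<in> index_equations Ts e (P, M, B, n)"
        unfolding index_equations_def prod.case
        by (rule UnI1[OF UnI1[OF UnI1[OF UnI2[OF image_eqI[rotated]]]]]) (simp add: c)
    qed auto
  next
    case False
    then have "bidual_scale c \<Phi> = \<Phi>" "bidual_norm s \<Phi> = 0"
      using dual_zero by (auto simp: bidual_scale_def bidual_norm_def fun_eq_iff intro!: cSUP_const)
    moreover have "x i \<Phi> = 0" for i
      using dom[of i] \<Phi> calculation(2) by (auto simp: norm_dominated_def)
    ultimately show ?thesis by simp
  qed
  have lim_canonical: "((\<lambda>i. x i (canonical_embedding s y)) \<longlongrightarrow> y) U" for y
  proof (rule lim_at[of "{canonical_embedding s y}" "{}" "{}"])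
    fix P :: "('k, 'e) functional2 set" and M :: "('e \<Rightarrow>\<^sub>L 'k) set" and B :: "'c set" and n
    assume "{canonical_embedding s y} \<subseteq> P" "{} \<subseteq> M" "{} \<subseteq> B"
    then have "y \<in> canonical_embedding s -` P" by simp
    then show "(\<lambda>f. f (canonical_embedding s y), y) \<in> index_equations Ts e (P, M, B, n)"
      unfolding index_equations_def prod.case
      by (rule UnI1[OF UnI1[OF UnI2[OF image_eqI[rotated]]]]) simp
  qed auto
  have lim_lact: "((\<lambda>i. x i (bidual_lact s T a \<Phi>) - T a (x i \<Phi>)) \<longlongrightarrow> 0) U"
    if "T \<in> Ts" "\<Phi> \<in> bidual s" for T a \<Phi>
  proof (rule lim_at[of "{\<Phi>}" "{}" "{a}"])
    fix P :: "('k, 'e) functional2 set" and M :: "('e \<Rightarrow>\<^sub>L 'k) set" and B :: "'c set" and n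
    assume "{\<Phi>} \<subseteq> P" "{} \<subseteq> M" "{a} \<subseteq> B"
    then have "(T, a, \<Phi>) \<in> Ts \<times> B \<times> (P \<inter> bidual s)" using that by simp
    then show "(\<lambda>f. f (bidual_lact s T a \<Phi>) - T a (f \<Phi>), 0) \<in> index_equations Ts e (P, M, B, n)"
      unfolding index_equations_def prod.case
      by (rule UnI1[OF UnI2[OF image_eqI[rotated]]]) simp
  qed auto
  have lim_apply: "((\<lambda>i. blinfun_apply \<mu> (x i \<Phi>)) \<longlongrightarrow> \<Phi> \<mu>) U"
    if \<Phi>: "\<Phi> \<in> bidual s" and \<mu>: "\<mu> \<in> dual s" for \<Phi> \<mu>
  proof (cases "e = 0")
    case True
    then have zero: "y = 0" for y :: 'e using e by blast
    have "\<mu> = 0"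
    proof (rule blinfun_eqI)
      show "blinfun_apply \<mu> y = blinfun_apply 0 y" for y
        using zero[of y] by (simp add: blinfun.zero_right)
    qed
    then show ?thesis by (simp add: bidual_apply_zero[OF \<Phi>])
  next
    case False
    have "((\<lambda>i. s (blinfun_apply \<mu> (x i \<Phi>)) e) \<longlongrightarrow> s (\<Phi> \<mu>) e) U"
    proof (rule lim_at[of "{\<Phi>}" "{\<mu>}" "{}"])
      fix P :: "('k, 'e) functional2 set" and M :: "('e \<Rightarrow>\<^sub>L 'k) set" and B :: "'c set" and n
      assume "{\<Phi>} \<subseteq> P" "{\<mu>} \<subseteq> M" "{} \<subseteq> B"
      then have "(\<Phi>, \<mu>) \<in> (P \<inter> bidual s) \<times> (M \<inter> dual s)" using \<Phi> \<mu> by simp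
      then show "(\<lambda>f. s (blinfun_apply \<mu> (f \<Phi>)) e, s (\<Phi> \<mu>) e) \<in> index_equations Ts e (P, M, B, n)"
        unfolding index_equations_def prod.case
        by (rule UnI2[OF image_eqI[rotated]]) simp
    qed auto
    \<comment> \<open>Dividing by \<open>norm e\<close> turns the vector equation back into the
      scalar one.\<close>
    then have "((\<lambda>i. norm (s (blinfun_apply \<mu> (x i \<Phi>)) e - s (\<Phi> \<mu>) e) / norm e) \<longlongrightarrow> 0 / norm e) U"
      using False by (intro tendsto_divide tendsto_const) (simp_all add: tendsto_norm_zero LIM_zero)
    then have "((\<lambda>i. norm (blinfun_apply \<mu> (x i \<Phi>) - \<Phi> \<mu>)) \<longlongrightarrow> 0) U"
      using False by (simp add: norm_scale flip: scale_left_diff_distrib)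
    then show ?thesis
      by (simp add: tendsto_norm_zero_iff LIM_zero_iff)
  qed
  have lim_norm: "((\<lambda>i. norm (x i \<Phi>)) \<longlongrightarrow> bidual_norm s \<Phi>) U" if \<Phi>: "\<Phi> \<in> bidual s" for \<Phi>
  proof (rule order_tendstoI)
    fix r assume r: "bidual_norm s \<Phi> < r"
    have "norm (x i \<Phi>) < r" for i
      using dom[of i] \<Phi> r by (auto simp: norm_dominated_def intro: le_less_trans)
    then show "eventually (\<lambda>i. norm (x i \<Phi>) < r) U" by (intro always_eventually) simp
  next
    fix r assume "r < bidual_norm s \<Phi>"
    \<comment> \<open>A nearly norming element of the unit ball; its values converge to
      \<open>\<Phi> \<mu>\<close> and keep the norms above \<open>r\<close>.\<close>
    then obtain \<mu> where \<mu>: "\<mu> \<in> dual s" "norm \<mu> \<le> 1" "r < norm (\<Phi> \<mu>)"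
      unfolding bidual_norm_def using bidual_bdd_above[OF \<Phi>] dual_zero
      by (subst (asm) less_cSUP_iff) auto
    have "eventually (\<lambda>i. r < norm (blinfun_apply \<mu> (x i \<Phi>))) U"
      using order_tendstoD(1)[OF tendsto_norm[OF lim_apply[OF \<Phi> \<mu>(1)]] \<mu>(3)] .
    then show "eventually (\<lambda>i. r < norm (x i \<Phi>)) U"
    proof eventually_elim
      case (elim i)
      also have "norm (blinfun_apply \<mu> (x i \<Phi>)) \<le> norm \<mu> * norm (x i \<Phi>)" by (rule norm_blinfun)
      also have "\<dots> \<le> norm (x i \<Phi>)" using \<mu>(2) by (simp add: mult_left_le_one_le)
      finally show ?case .
    qed
  qed

  \<comment> \<open>The map \<open>K\<close> and its properties\<close>
  define K where "K \<Phi> = ultrapower_class U (\<lambda>i. x i \<Phi>)" for \<Phi>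
  have "linear_isometry_into_ultrapower s U K"
    unfolding linear_isometry_into_ultrapower_def
  proof (intro conjI ballI allI Pi_I)
    fix \<Phi> \<Psi> assume \<Phi>: "\<Phi> \<in> bidual s"
    show "K \<Phi> \<in> ultrapower U"
      unfolding K_def by (intro ultrapower_class_in_ultrapower bdd \<Phi>)
    show "ultrapower_norm U (K \<Phi>) = bidual_norm s \<Phi>"
      unfolding K_def by (intro ultrapower_norm_class U_bot bdd lim_norm \<Phi>)
    show "K (bidual_scale c \<Phi>) = ultrapower_scale s U c (K \<Phi>)" for c
      unfolding K_def ultrapower_scale_def ultrapower_class_linear[OF bounded_linear_scale bdd[OF \<Phi>]]
      by (intro ultrapower_class_eqI bdd bidual_scale_in_bidual lim_scale \<Phi>
          bounded_families_linear[OF bounded_linear_scale])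
    assume \<Psi>: "\<Psi> \<in> bidual s"
    show "K (bidual_add \<Phi> \<Psi>) = ultrapower_add U (K \<Phi>) (K \<Psi>)"
      unfolding K_def ultrapower_add_class[OF bdd[OF \<Phi>] bdd[OF \<Psi>]]
      using lim_add[OF \<Phi> \<Psi>]
      by (intro ultrapower_class_eqI bdd bidual_add_in_bidual bounded_families_add \<Phi> \<Psi>)
        (simp add: diff_diff_eq)
  qed
  moreover have "left_module_hom_into_ultrapower s T U K" if T: "T \<in> Ts" for T
    unfolding left_module_hom_into_ultrapower_def
  proof (intro allI ballI)
    fix a \<Phi> assume \<Phi>: "\<Phi> \<in> bidual s"
    have bl: "bounded_linear (T a)" using ops[OF T] by (simp add: operator_family_def)
    show "K (bidual_lact s T a \<Phi>) = ultrapower_lact T U a (K \<Phi>)"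
      unfolding K_def ultrapower_lact_def ultrapower_class_linear[OF bl bdd[OF \<Phi>]]
      by (intro ultrapower_class_eqI bdd bidual_lact_in_bidual lim_lact ops T \<Phi>
          bounded_families_linear[OF bl])
  qed
  moreover have "ultrapower_sigma s U (K \<Phi>) = \<Phi>" if \<Phi>: "\<Phi> \<in> bidual s" for \<Phi>
  proof
    fix \<mu>
    show "ultrapower_sigma s U (K \<Phi>) \<mu> = \<Phi> \<mu>"
    proof (cases "\<mu> \<in> dual s")
      case True
      then show ?thesis
        unfolding K_def by (intro ultrapower_sigma_class U_bot bdd lim_apply \<Phi>)
    next
      case False
      then show ?thesis by (simp add: ultrapower_sigma_def bidual_off_dual[OF \<Phi>])
    qed
  qed
  moreover have "K (canonical_embedding s y) = ultrapower_canonical U y" for y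
    unfolding K_def ultrapower_canonical_def
  proof (rule ultrapower_class_eqI[OF bdd[OF canonical_embedding_in_bidual]])
    show "((\<lambda>i. x i (canonical_embedding s y) - y) \<longlongrightarrow> 0) U"
      using lim_canonical by (rule LIM_zero)
  qed (simp add: bounded_families_def)
  ultimately show ?thesis using U(2) by blast
qed

end

section \<open>Left modules, right modules and bimodules\<close>

lemma (in banach_left_module) operator_family_lact: "E.operator_family l"
  unfolding E.operator_family_def
  using bounded_bilinear.bounded_linear_right[OF lact_bounded_bilinear] lact_scale_right by blast

lemma (in banach_right_module) operator_family_ract: "E.operator_family (\<lambda>a x. r x a)"
  unfolding E.operator_family_def
  using bounded_bilinear.bounded_linear_left[OF ract_bounded_bilinear] ract_scale_left by blast

text \<open>With the arguments of the action exchanged, both sides unfold to the same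
  formula.\<close>

lemma right_module_hom_iff_left:
  "right_module_hom_into_ultrapower s r U K \<longleftrightarrow>
    left_module_hom_into_ultrapower s (\<lambda>a x. r x a) U K"
  unfolding right_module_hom_into_ultrapower_def left_module_hom_into_ultrapower_def
    bidual_ract_def bidual_lact_def ultrapower_ract_def ultrapower_lact_def
    dual_lact_def dual_ract_def ..

theorem theorem3p2:
  fixes sA :: "'k::real_or_complex \<Rightarrow> 'a::{real_normed_algebra,banach} \<Rightarrow> 'a"
    and sE :: "'k \<Rightarrow> 'e::banach \<Rightarrow> 'e"
  shows
    "(\<forall>l. banach_left_module sA sE l \<longrightarrow>
        (\<exists>(U :: ('k, 'e, 'a) ultra_index filter) K.
           ultrafilter U \<and> nonprincipal U \<and> countably_incomplete U \<and>
           linear_isometry_into_ultrapower sE U K \<and>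
           left_module_hom_into_ultrapower sE l U K \<and>
           (\<forall>\<Phi>\<in>bidual sE. ultrapower_sigma sE U (K \<Phi>) = \<Phi>) \<and>
           (\<forall>x. K (canonical_embedding sE x) = ultrapower_canonical U x))) \<and>
     (\<forall>r. banach_right_module sA sE r \<longrightarrow>
        (\<exists>(U :: ('k, 'e, 'a) ultra_index filter) K.
           ultrafilter U \<and> nonprincipal U \<and> countably_incomplete U \<and>
           linear_isometry_into_ultrapower sE U K \<and>
           right_module_hom_into_ultrapower sE r U K \<and>
           (\<forall>\<Phi>\<in>bidual sE. ultrapower_sigma sE U (K \<Phi>) = \<Phi>) \<and>
           (\<forall>x. K (canonical_embedding sE x) = ultrapower_canonical U x))) \<and>
     (\<forall>l r. banach_bimodule sA sE l r \<longrightarrow>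
        (\<exists>(U :: ('k, 'e, 'a) ultra_index filter) K.
           ultrafilter U \<and> nonprincipal U \<and> countably_incomplete U \<and>
           linear_isometry_into_ultrapower sE U K \<and>
           left_module_hom_into_ultrapower sE l U K \<and>
           right_module_hom_into_ultrapower sE r U K \<and>
           (\<forall>\<Phi>\<in>bidual sE. ultrapower_sigma sE U (K \<Phi>) = \<Phi>) \<and>
           (\<forall>x. K (canonical_embedding sE x) = ultrapower_canonical U x)))"
proof (intro conjI allI impI)
  fix l assume "banach_left_module sA sE l"
  then interpret banach_left_module sA sE l .
  show "\<exists>(U :: ('k, 'e, 'a) ultra_index filter) K.
      ultrafilter U \<and> nonprincipal U \<and> countably_incomplete U \<and>
      linear_isometry_into_ultrapower sE U K \<and>
      left_module_hom_into_ultrapower sE l U K \<and>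
      (\<forall>\<Phi>\<in>bidual sE. ultrapower_sigma sE U (K \<Phi>) = \<Phi>) \<and>
      (\<forall>x. K (canonical_embedding sE x) = ultrapower_canonical U x)"
    using E.bidual_into_ultrapower[of "{l}"] operator_family_lact by simp
next
  fix r assume "banach_right_module sA sE r"
  then interpret banach_right_module sA sE r .
  show "\<exists>(U :: ('k, 'e, 'a) ultra_index filter) K.
      ultrafilter U \<and> nonprincipal U \<and> countably_incomplete U \<and>
      linear_isometry_into_ultrapower sE U K \<and>
      right_module_hom_into_ultrapower sE r U K \<and>
      (\<forall>\<Phi>\<in>bidual sE. ultrapower_sigma sE U (K \<Phi>) = \<Phi>) \<and>
      (\<forall>x. K (canonical_embedding sE x) = ultrapower_canonical U x)"
    using E.bidual_into_ultrapower[of "{\<lambda>a x. r x a}"] operator_family_ract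
    by (simp add: right_module_hom_iff_left)
next
  fix l r assume "banach_bimodule sA sE l r"
  then interpret banach_bimodule sA sE l r .
  have ops: "E.operator_family T" if "T \<in> {l, \<lambda>a x. r x a}" for T
    using that operator_family_lact operator_family_ract by auto
  show "\<exists>(U :: ('k, 'e, 'a) ultra_index filter) K.
      ultrafilter U \<and> nonprincipal U \<and> countably_incomplete U \<and>
      linear_isometry_into_ultrapower sE U K \<and>
      left_module_hom_into_ultrapower sE l U K \<and>
      right_module_hom_into_ultrapower sE r U K \<and>
      (\<forall>\<Phi>\<in>bidual sE. ultrapower_sigma sE U (K \<Phi>) = \<Phi>) \<and>
      (\<forall>x. K (canonical_embedding sE x) = ultrapower_canonical U x)"
    \<comment> \<open>Both actions enter the same equations, so a single \<open>K\<close> respects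
      both.\<close>
    using E.bidual_into_ultrapower[of "{l, \<lambda>a x. r x a}", OF _ ops]
    by (simp add: right_module_hom_iff_left conj_assoc)
qed

end
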